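(* Let $n\ge 6$ be an even integer. Let $$C=\{(i,j;i+j)\mid 0\le i,j\le n-1,\ (0\le i+j\le \tfrac n2-2)\ \text{or}\ (\tfrac{3n}{2}-1\le i+j\le 2n-2)\}$$ and $$D=\Big(C\setminus\{(n-1,j;j-1)\mid \tfrac n2+1\le j\le n-2\}\Big)\cup\{(\tfrac n2,j;j-1)\mid \tfrac n2+1\le j\le n-2\}\cup\{(\tfrac n2,\tfrac n2-1;n-1)\},$$ where the third component of every triple is taken modulo $n$ in $\{0,\dots,n-1\}$. Then $D$ is a critical set of size $\frac{n^2}{4}+1$ (in a Latin square of order $n$).
   Context: Rows, columns and symbols are numbered $0,\dots,n-1$. A partial Latin square of order $n$ is an $n\times n$ array in which each cell is empty or contains one symbol of $\{0,\dots,n-1\}$, each symbol occurring at most once in each row and column; it is identified with the set of triples $(i,j;k)$ meaning that symbol $k$ occurs in row $i$, column $j$. Its size is its number of entries; it is a Latin square if it has $n^2$ entries. A critical set (of order $n$) is a proper subset $D$ of a Latin square of order $n$ such that $D$ is contained in exactly one Latin square of order $n$ (on the same symbol set), and such that for every $t\in D$ the set $D\setminus\{t\}$ is contained in more than one Latin square of order $n$. *)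

theory Defs
  imports Main
begin

text \<open>A triple \<open>(i, j, k)\<close> stands for the entry \<open>(i, j; k)\<close>: symbol \<open>k\<close> in row \<open>i\<close>, column \<open>j\<close>.\<close>

type_synonym entry = "nat \<times> nat \<times> nat"

definition partial_latin_square :: "nat \<Rightarrow> entry set \<Rightarrow> bool" where
  "partial_latin_square n P \<longleftrightarrow>
     P \<subseteq> {0..<n} \<times> {0..<n} \<times> {0..<n} \<and>
     (\<forall>i j k k'. (i, j, k) \<in> P \<and> (i, j, k') \<in> P \<longrightarrow> k = k') \<and>
     (\<forall>i j j' k. (i, j, k) \<in> P \<and> (i, j', k) \<in> P \<longrightarrow> j = j') \<and>
     (\<forall>i i' j k. (i, j, k) \<in> P \<and> (i', j, k) \<in> P \<longrightarrow> i = i')"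

definition latin_square :: "nat \<Rightarrow> entry set \<Rightarrow> bool" where
  "latin_square n L \<longleftrightarrow> partial_latin_square n L \<and> card L = n ^ 2"

definition critical_set :: "nat \<Rightarrow> entry set \<Rightarrow> bool" where
  "critical_set n D \<longleftrightarrow>
     (\<exists>L. latin_square n L \<and> D \<subset> L) \<and>
     (\<exists>!L. latin_square n L \<and> D \<subseteq> L) \<and>
     (\<forall>t\<in>D. \<exists>L L'. latin_square n L \<and> latin_square n L' \<and> L \<noteq> L' \<and>
                D - {t} \<subseteq> L \<and> D - {t} \<subseteq> L')"

text \<open>The sets below are meant for even \<open>n \<ge> 6\<close>: then the halves are exact and no subtraction
  on \<open>nat\<close> truncates, in particular \<open>j \<ge> 1\<close> wherever \<open>j - 1\<close> occurs.\<close>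

definition set_C :: "nat \<Rightarrow> entry set" where
  "set_C n = {(i, j, (i + j) mod n) | i j.
     i \<le> n - 1 \<and> j \<le> n - 1 \<and>
     (i + j \<le> n div 2 - 2 \<or> (3 * n) div 2 - 1 \<le> i + j \<and> i + j \<le> 2 * n - 2)}"

definition set_D :: "nat \<Rightarrow> entry set" where
  "set_D n =
     (set_C n - {(n - 1, j, (j - 1) mod n) | j. n div 2 + 1 \<le> j \<and> j \<le> n - 2})
     \<union> {(n div 2, j, (j - 1) mod n) | j. n div 2 + 1 \<le> j \<and> j \<le> n - 2}
     \<union> {(n div 2, n div 2 - 1, (n - 1) mod n)}"

end

theory Submission
  imports Defs
begin

text \<open>
  Write \<open>n = 2 m\<close>. The completion of \<open>D\<close> differs from the back circulant square \<open>i + j mod n\<close> only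
  in rows \<open>m\<close> and \<open>n - 1\<close> and, in the rows between them, by exchanging the symbols \<open>n - 2\<close> and
  \<open>n - 1\<close> in the columns below \<open>m - 1\<close> and by exchanging the columns \<open>m - 1\<close> and \<open>m\<close>.

  Uniqueness: the completion is forced entry by entry. First the symbols \<open>m - 1, m, \<dots>, n - 1\<close> are
  placed in this order (the lower half of \<open>n - 2\<close> comes after \<open>n - 1\<close>), each time because a row has
  only one column left for the symbol. The remaining cells are then filled column by column,
  because only one symbol is left for the cell.

  Necessity: for each entry of \<open>D\<close> some columns of the completion can have two or three of their
  entries permuted so that the result is a Latin square in which this is the only entry of \<open>D\<close>
  that changed. Most entries lie in an intercalate; the others need a trade between two
  neighbouring rows, closed up by a third row. The conjugation
  \<open>(i, j; k) \<mapsto> (i, m - 2 - k; m - 2 - j)\<close> modulo \<open>n\<close> preserves \<open>D\<close> and halves the number of cases.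
\<close>

subsection \<open>Latin squares as functions\<close>

definition graph :: "nat \<Rightarrow> (nat \<Rightarrow> nat \<Rightarrow> nat) \<Rightarrow> entry set" where
  "graph n f = {(i, j, f i j) | i j. i < n \<and> j < n}"

text \<open>Values outside the \<open>n\<close> by \<open>n\<close> square are unconstrained, so
  equality of squares is expressed through \<open>graph\<close> and not as equality of
  functions.\<close>

definition latin_fun :: "nat \<Rightarrow> (nat \<Rightarrow> nat \<Rightarrow> nat) \<Rightarrow> bool" where
  "latin_fun n f \<longleftrightarrow> (\<forall>i<n. \<forall>j<n. f i j < n) \<and> (\<forall>i<n. inj_on (f i) {..<n}) \<and>
     (\<forall>j<n. inj_on (\<lambda>i. f i j) {..<n})"

lemma latin_funD:
  assumes "latin_fun n f" "i < n" "j < n"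
  shows "f i j < n"
    and "j' < n \<Longrightarrow> f i j = f i j' \<Longrightarrow> j = j'"
    and "i' < n \<Longrightarrow> f i j = f i' j \<Longrightarrow> i = i'"
proof -
  show "f i j < n"
    using assms by (simp add: latin_fun_def)
  have "inj_on (f i) {..<n}" "inj_on (\<lambda>i. f i j) {..<n}"
    using assms by (simp_all add: latin_fun_def)
  then show "j' < n \<Longrightarrow> f i j = f i j' \<Longrightarrow> j = j'" "i' < n \<Longrightarrow> f i j = f i' j \<Longrightarrow> i = i'"
    using assms(2,3) by (auto dest: inj_onD)
qed

lemma mem_graph [simp]: "(i, j, k) \<in> graph n f \<longleftrightarrow> i < n \<and> j < n \<and> k = f i j"
  by (auto simp: graph_def)

lemma card_graph: "card (graph n f) = n\<^sup>2"
proof -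
  have "graph n f = (\<lambda>(i, j). (i, j, f i j)) ` ({..<n} \<times> {..<n})"
    by (auto simp: graph_def)
  moreover have "inj_on (\<lambda>(i, j). (i, j, f i j)) ({..<n} \<times> {..<n})"
    by (rule inj_onI) auto
  ultimately show ?thesis
    by (simp add: card_image power2_eq_square)
qed

lemma latin_square_graph:
  assumes "latin_fun n f"
  shows "latin_square n (graph n f)"
  unfolding latin_square_def partial_latin_square_def mem_graph
proof (intro conjI allI impI)
  show "graph n f \<subseteq> {0..<n} \<times> {0..<n} \<times> {0..<n}"
    using latin_funD(1)[OF assms] by (auto simp: graph_def)
qed (use latin_funD(2,3)[OF assms] card_graph in \<open>blast | simp\<close>)+

text \<open>The projection of entries to cells is injective, and there are as many entries as cells.
  Hence every cell is filled, and a function can be read off.\<close>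

lemma latin_square_imp_graph:
  assumes "latin_square n P"
  obtains f where "latin_fun n f" "P = graph n f"
proof -
  define p where "p = (\<lambda>(i :: nat, j :: nat, k :: nat). (i, j))"
  have P: "P \<subseteq> {0..<n} \<times> {0..<n} \<times> {0..<n}" "card P = n\<^sup>2"
    and cell: "\<And>i j k k'. (i, j, k) \<in> P \<Longrightarrow> (i, j, k') \<in> P \<Longrightarrow> k = k'"
    and row: "\<And>i j j' k. (i, j, k) \<in> P \<Longrightarrow> (i, j', k) \<in> P \<Longrightarrow> j = j'"
    and col: "\<And>i i' j k. (i, j, k) \<in> P \<Longrightarrow> (i', j, k) \<in> P \<Longrightarrow> i = i'"
    using assms unfolding latin_square_def partial_latin_square_def by blast+
  have "inj_on p P"
    using cell by (auto simp: inj_on_def p_def)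
  then have "card (p ` P) = card ({..<n} \<times> {..<n})"
    using P(2) by (simp add: card_image power2_eq_square)
  moreover have "p ` P \<subseteq> {..<n} \<times> {..<n}"
    using P(1) by (auto simp: p_def)
  ultimately have "p ` P = {..<n} \<times> {..<n}"
    by (intro card_subset_eq) auto
  then have "\<exists>k. (i, j, k) \<in> P" if "i < n" "j < n" for i j
  proof -
    have "(i, j) \<in> p ` P"
      using that \<open>p ` P = _\<close> by simp
    then show ?thesis
      by (auto simp: p_def)
  qed
  then obtain f where f: "\<And>i j. i < n \<Longrightarrow> j < n \<Longrightarrow> (i, j, f i j) \<in> P"
    by metis
  have "t \<in> P \<longleftrightarrow> t \<in> graph n f" for t
  proof (cases t)
    case (fields i j k)
    then show ?thesis
      using P(1) cell[of i j k "f i j"] f[of i j] by auto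
  qed
  then have "P = graph n f"
    by blast
  moreover have "latin_fun n f"
    unfolding latin_fun_def inj_on_def
  proof (intro conjI allI impI ballI)
    show "f i j < n" if "i < n" "j < n" for i j
      using f[OF that] P(1) by auto
    show "j = j'" if "i < n" "j \<in> {..<n}" "j' \<in> {..<n}" "f i j = f i j'" for i j j'
      using row[of i j "f i j" j'] f[of i j] f[of i j'] that by simp
    show "i = i'" if "j < n" "i \<in> {..<n}" "i' \<in> {..<n}" "f i j = f i' j" for i i' j
      using col[of i j "f i j" i'] f[of i j] f[of i' j] that by simp
  qed
  ultimately show ?thesis
    using that by blast
qed

text \<open>By counting: on \<open>T\<close> the new function takes as many values as
  \<open>f\<close>, so it is injective there, and these values stay disjoint from the ones outside
  \<open>T\<close>.\<close>

lemma inj_on_rearranged: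
  assumes f: "inj_on f A" and T: "finite T" "T \<subseteq> A"
    and same: "\<And>x. x \<in> A - T \<Longrightarrow> g x = f x" and img: "g ` T = f ` T"
  shows "inj_on g A"
proof -
  have "card (g ` T) = card T"
    unfolding img by (rule card_image[OF inj_on_subset[OF f T(2)]])
  then have "inj_on g T"
    by (rule eq_card_imp_inj_on[OF T(1)])
  moreover have "inj_on g (A - T)"
    using same inj_on_subset[OF f, of "A - T"] by (simp add: inj_on_def)
  moreover have "g ` T \<inter> g ` (A - T) = {}"
  proof -
    have "g ` (A - T) = f ` (A - T)"
      using same by (intro image_cong) auto
    then show ?thesis
      using f T(2) unfolding img by (auto simp: inj_on_def)
  qed
  moreover have "T - (A - T) = T" "A - T - T = A - T"
    by blast+
  ultimately have "inj_on g (T \<union> (A - T))"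
    by (simp only: inj_on_Un simp_thms)
  moreover have "T \<union> (A - T) = A"
    using T(2) by blast
  ultimately show ?thesis
    by simp
qed

text \<open>The common form of all trades below. Permuting entries inside a column cannot spoil the
  column, so the only condition on symbols is that each row in \<open>R\<close> keeps its set of
  symbols on \<open>T\<close>.\<close>

lemma latin_fun_permute_rows:
  assumes f: "latin_fun n f" and R: "R \<subseteq> {..<n}" and T: "T \<subseteq> {..<n}"
    and same: "\<And>i j. i \<notin> R \<or> j \<notin> T \<Longrightarrow> p j i = i"
    and perm: "\<And>j. j \<in> T \<Longrightarrow> p j ` R = R"
    and rows: "\<And>i. i \<in> R \<Longrightarrow> (\<lambda>j. f (p j i) j) ` T = f i ` T"
  shows "latin_fun n (\<lambda>i j. f (p j i) j)"
proof -
  have fin: "finite R" "finite T"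
    using R T finite_subset by blast+
  have perm': "p j ` R = R" for j
  proof (cases "j \<in> T")
    case False
    then show ?thesis
      using same by (simp add: image_def)
  qed (rule perm)
  have "inj_on (\<lambda>j. f (p j i) j) {..<n}" if "i < n" for i
  proof (rule inj_on_rearranged[OF _ fin(2) T])
    show "inj_on (f i) {..<n}"
      using f that by (simp add: latin_fun_def)
    show "f (p j i) j = f i j" if "j \<in> {..<n} - T" for j
      using that same[of i j] by simp
    show "(\<lambda>j. f (p j i) j) ` T = f i ` T"
      using rows[of i] same[of i] by (cases "i \<in> R") auto
  qed
  moreover have "inj_on (\<lambda>i. f (p j i) j) {..<n}" if "j < n" for j
  proof (rule inj_on_rearranged[OF _ fin(1) R])
    show "inj_on (\<lambda>i. f i j) {..<n}"
      using f that by (simp add: latin_fun_def)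
    show "f (p j i) j = f i j" if "i \<in> {..<n} - R" for i
      using that same[of i j] by simp
    show "(\<lambda>i. f (p j i) j) ` R = (\<lambda>i. f i j) ` R"
      using arg_cong[OF perm'[of j], of "\<lambda>A. (\<lambda>i. f i j) ` A"] by (simp add: image_image)
  qed
  moreover have "f (p j i) j < n" if "i < n" "j < n" for i j
  proof -
    have "p j i < n"
      using perm'[of j] same[of i j] R \<open>i < n\<close> by (cases "i \<in> R") auto
    then show ?thesis
      using latin_funD(1)[OF f _ \<open>j < n\<close>] by blast
  qed
  ultimately show ?thesis
    by (simp add: latin_fun_def)
qed

subsection \<open>The completed square\<close>

definition sq :: "nat \<Rightarrow> nat \<Rightarrow> nat \<Rightarrow> nat" where
  "sq m i j =
    (if i < m then if i + j < 2 * m then i + j else i + j - 2 * m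
     else if i = m then
       if j = 0 then 2 * m - 2 else if j + 1 = m then 2 * m - 1 else if j = m then m - 2
       else if j + 1 = 2 * m then m - 1 else j - 1
     else if i + 1 = 2 * m then
       if j + 2 < m then m + j else if j + 2 = m then 2 * m - 1 else if j + 1 = m then 0
       else if j = m then m - 1 else if j + 1 = 2 * m then 2 * m - 2 else j - m
     else
       if j + 1 = m then i - m else if j = m then i - m - 1
       else if i + j + 2 = 2 * m then 2 * m - 1 else if i + j + 1 = 2 * m then 2 * m - 2
       else if i + j < 2 * m then i + j else i + j - 2 * m)"

lemma sq_top: "i < m \<Longrightarrow> sq m i j = (if i + j < 2 * m then i + j else i + j - 2 * m)"
  by (simp add: sq_def)

lemma sq_m:
  "sq m m j =
    (if j = 0 then 2 * m - 2 else if j + 1 = m then 2 * m - 1 else if j = m then m - 2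
     else if j + 1 = 2 * m then m - 1 else j - 1)"
  by (simp add: sq_def)

lemma sq_last:
  "3 \<le> m \<Longrightarrow> i + 1 = 2 * m \<Longrightarrow> sq m i j =
    (if j + 2 < m then m + j else if j + 2 = m then 2 * m - 1 else if j + 1 = m then 0
     else if j = m then m - 1 else if j + 1 = 2 * m then 2 * m - 2 else j - m)"
  by (simp add: sq_def)

lemma sq_low:
  "m < i \<Longrightarrow> i + 1 < 2 * m \<Longrightarrow> sq m i j =
    (if j + 1 = m then i - m else if j = m then i - m - 1
     else if i + j + 2 = 2 * m then 2 * m - 1 else if i + j + 1 = 2 * m then 2 * m - 2
     else if i + j < 2 * m then i + j else i + j - 2 * m)"
  by (simp add: sq_def)

lemma row_cases:
  fixes i m :: nat
  assumes "i < 2 * m"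
  obtains "i < m" | "i = m" | "m < i" "i + 1 < 2 * m" | "i + 1 = 2 * m" 
  using assms by linarith

lemma sq_less:
  assumes "3 \<le> m" "i < 2 * m" "j < 2 * m"
  shows "sq m i j < 2 * m"
  using assms(2) by (cases rule: row_cases) (use assms in \<open>auto simp: sq_top sq_m sq_last sq_low\<close>)

lemma sq_row_inj:
  assumes "3 \<le> m" "i < 2 * m"
  shows "inj_on (sq m i) {..<2 * m}"
proof (rule inj_onI)
  fix x y
  assume xy: "x \<in> {..<2 * m}" "y \<in> {..<2 * m}" "sq m i x = sq m i y"
  show "x = y"
    using assms(2) by (cases rule: row_cases)
     (use assms xy in \<open>auto simp: sq_top sq_m sq_last sq_low split: if_splits\<close>)
qed

lemma sq_col_neq:
  assumes m: "3 \<le> m" and "x < y" "y < 2 * m" "j < 2 * m"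
  shows "sq m x j \<noteq> sq m y j"
proof -
  have "y < 2 * m" "x < 2 * m" using assms by auto
  then show ?thesis
    by - (erule row_cases; erule row_cases; use assms
        in \<open>auto simp: sq_top sq_m sq_last sq_low split: if_splits\<close>)
qed

lemma latin_fun_sq:
  assumes "3 \<le> m"
  shows "latin_fun (2 * m) (sq m)"
  using assms unfolding latin_fun_def
  by (auto simp: sq_less sq_row_inj intro!: linorder_inj_onI' dest: sq_col_neq)

subsection \<open>The critical set\<close>

text \<open>\<open>set_D (2 * m)\<close> without subtraction and \<open>mod\<close>.\<close>

definition crit :: "nat \<Rightarrow> entry set" where
  "crit m = {(i, j, k). i < 2 * m \<and> j < 2 * m \<and>
     (i + j + 2 \<le> m \<and> k = i + j
      \<or> i = m \<and> j + 1 = m \<and> k + 1 = 2 * m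
      \<or> i = m \<and> m < j \<and> j + 1 < 2 * m \<and> k + 1 = j
      \<or> m \<le> i \<and> i + 1 < 2 * m \<and> 3 * m \<le> i + j + 1 \<and> k + 2 * m = i + j
      \<or> i + 1 = 2 * m \<and> j = m \<and> k + 1 = m
      \<or> i + 1 = 2 * m \<and> j + 1 = 2 * m \<and> k + 2 = 2 * m)}"

text \<open>In the last row the lower triangle of \<open>set_C\<close> occupies columns
  \<open>m\<close> to \<open>2 * m - 1\<close>. Deleting the inner ones leaves two entries, listed
  separately in \<open>crit\<close>; the deleted ones reappear in row \<open>m\<close>.\<close>

lemma set_D_eq_crit:
  assumes "3 \<le> m"
  shows "set_D (2 * m) = crit m"
proof -
  have half: "2 * m div 2 = m" "3 * (2 * m) div 2 = 3 * m"
    by simp_all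
  have C: "(i, j, k) \<in> set_C (2 * m) \<longleftrightarrow> i < 2 * m \<and> j < 2 * m \<and>
     (i + j + 2 \<le> m \<and> k = i + j \<or> 3 * m \<le> i + j + 1 \<and> k + 2 * m = i + j)" for i j k
  proof -
    have "(i, j, k) \<in> set_C (2 * m) \<longleftrightarrow> i \<le> 2 * m - 1 \<and> j \<le> 2 * m - 1 \<and> k = (i + j) mod (2 * m) \<and>
        (i + j \<le> m - 2 \<or> 3 * m - 1 \<le> i + j \<and> i + j \<le> 2 * (2 * m) - 2)"
      unfolding set_C_def half by blast
    moreover have "(i + j) mod (2 * m) = (if i + j < 2 * m then i + j else i + j - 2 * m)"
      if "i \<le> 2 * m - 1" "j \<le> 2 * m - 1"
      using that assms by (simp add: mod_if)
    moreover have "i \<le> 2 * m - 1 \<longleftrightarrow> i < 2 * m" "j \<le> 2 * m - 1 \<longleftrightarrow> j < 2 * m"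
      using assms by linarith+
    ultimately have "(i, j, k) \<in> set_C (2 * m) \<longleftrightarrow> i < 2 * m \<and> j < 2 * m \<and>
        k = (if i + j < 2 * m then i + j else i + j - 2 * m) \<and>
        (i + j \<le> m - 2 \<or> 3 * m - 1 \<le> i + j \<and> i + j \<le> 2 * (2 * m) - 2)"
      by metis
    then show ?thesis
      using assms by (simp only:) (cases "i + j < 2 * m"; simp; linarith)
  qed
  \<comment> \<open>The row \<open>a\<close> is a parameter so that both the deleted entries
    (\<open>a = 2 * m - 1\<close>) and the inserted ones (\<open>a = m\<close>) are covered.\<close>
  have shift: "(i, j, k) \<in> {(a, j, (j - 1) mod (2 * m)) | j. m + 1 \<le> j \<and> j \<le> 2 * m - 2}
      \<longleftrightarrow> i = a \<and> m < j \<and> j + 1 < 2 * m \<and> k + 1 = j" for a i j k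
  proof -
    have "(j - 1) mod (2 * m) = j - 1" if "j \<le> 2 * m - 2"
      using assms that by simp
    then show ?thesis
      using assms by auto
  qed
  have [simp]: "(2 * m - 1) mod (2 * m) = 2 * m - 1"
    using assms by simp
  have "(i, j, k) \<in> set_D (2 * m) \<longleftrightarrow> (i, j, k) \<in> crit m" for i j k
  proof -
    consider "i < m" | "i = m" | "m < i" "i + 1 < 2 * m" | "i + 1 = 2 * m" | "2 * m \<le> i"
      by linarith
    then show ?thesis
      unfolding set_D_def half Un_iff Diff_iff shift C
      by cases (use assms in \<open>simp_all add: crit_def, linarith+\<close>)
  qed
  then show ?thesis
    by auto
qed

lemma card_crit:
  assumes "3 \<le> m"
  shows "card (crit m) = m\<^sup>2 + 1"
proof -
  \<comment> \<open>Reducing both coordinates modulo \<open>m\<close> makes the two triangles tile an \<open>m \<times> m\<close> square.\<close>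
  define h where "h = (\<lambda>(a :: nat, b :: nat). if a + b + 2 \<le> m then (a, b, a + b)
     else if a + 1 = m \<and> 0 < b \<and> b + 1 < m then (m, b + m, b + m - 1) else (a + m, b + m, a + b))"
  have h: "crit m = insert (m, m - 1, 2 * m - 1) (h ` ({..<m} \<times> {..<m}))"
  proof (intro subset_antisym subsetI)
    fix t assume t: "t \<in> crit m"
    obtain i j k where "t = (i, j, k)"
      using prod_cases3 by blast
    then consider "i + j + 2 \<le> m" "k = i + j" | "i = m" "j + 1 = m" "k + 1 = 2 * m"
      | "i = m" "m < j" "j + 1 < 2 * m" "k + 1 = j"
      | "m \<le> i" "i + 1 < 2 * m" "3 * m \<le> i + j + 1" "k + 2 * m = i + j" "j < 2 * m"
      | "i + 1 = 2 * m" "j = m" "k + 1 = m" | "i + 1 = 2 * m" "j + 1 = 2 * m" "k + 2 = 2 * m"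
      using t by (auto simp: crit_def)
    then have "t = (m, m - 1, 2 * m - 1) \<or> (\<exists>a b. a < m \<and> b < m \<and> t = h (a, b))"
    proof cases
      case 1
      then show ?thesis
        using \<open>t = _\<close> by (intro disjI2 exI[of _ i] exI[of _ j]) (auto simp: h_def)
    next
      case 2
      then show ?thesis
        using \<open>t = _\<close> by auto
    next
      case 3
      \<comment> \<open>These entries were moved up from the last row, so their preimage lies in row
        \<open>m - 1\<close> of the small square.\<close>
      then show ?thesis
        using \<open>t = _\<close> by (intro disjI2 exI[of _ "m - 1"] exI[of _ "j - m"]) (auto simp: h_def)
    qed (use \<open>t = _\<close> assms in \<open>intro disjI2 exI[of _ "i - m"] exI[of _ "j - m"]; auto simp: h_def\<close>)+
    then show "t \<in> insert (m, m - 1, 2 * m - 1) (h ` ({..<m} \<times> {..<m}))"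
      by auto
  next
    fix t assume "t \<in> insert (m, m - 1, 2 * m - 1) (h ` ({..<m} \<times> {..<m}))"
    then consider "t = (m, m - 1, 2 * m - 1)" | a b where "a < m" "b < m" "t = h (a, b)"
      by auto
    then show "t \<in> crit m"
      by cases (use assms in \<open>auto simp: crit_def h_def\<close>)
  qed
  have "(m, m - 1, 2 * m - 1) \<notin> h ` ({..<m} \<times> {..<m})"
    using assms by (auto simp: h_def split: if_splits)
  moreover have "inj_on h ({..<m} \<times> {..<m})"
    by (rule inj_onI) (auto simp: h_def split: if_splits)
  ultimately show ?thesis
    unfolding h by (simp add: card_image power2_eq_square)
qed

text \<open>\<open>flip m x = m - 2 - x\<close> modulo \<open>2 * m\<close>.\<close>

definition flip :: "nat \<Rightarrow> nat \<Rightarrow> nat" where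
  "flip m x = (if x + 2 \<le> m then m - 2 - x else 3 * m - 2 - x)"

text \<open>Modulo \<open>2 * m\<close>, the equations \<open>i + j = k\<close> and
  \<open>i + flip m k = flip m j\<close> are equivalent, so the back circulant square is mapped to
  itself.\<close>

definition conjugate :: "nat \<Rightarrow> entry \<Rightarrow> entry" where
  "conjugate m = (\<lambda>(i, j, k). (i, flip m k, flip m j))"

lemma flip_less: "3 \<le> m \<Longrightarrow> x < 2 * m \<Longrightarrow> flip m x < 2 * m"
  by (auto simp: flip_def)

text \<open>Additive forms of the two branches of \<open>flip\<close>, from which linear arithmetic
  works without truncated subtraction.\<close>

lemma flip_add:
  "x + 2 \<le> m \<Longrightarrow> flip m x + x + 2 = m"
  "m \<le> x + 1 \<Longrightarrow> x < 2 * m \<Longrightarrow> flip m x + x + 2 = 3 * m"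
  by (auto simp: flip_def)

lemma flip_flip: "x < 2 * m \<Longrightarrow> flip m (flip m x) = x"
  by (auto simp: flip_def)

lemma conjugate_conjugate:
  "t \<in> {0..<2 * m} \<times> {0..<2 * m} \<times> {0..<2 * m} \<Longrightarrow> conjugate m (conjugate m t) = t"
  by (auto simp: conjugate_def flip_flip)

text \<open>Exchanging columns with symbols turns the condition on cells into the one on rows and
  conversely; the condition on columns is preserved.\<close>

lemma latin_square_conjugate:
  assumes m: "3 \<le> m" and L: "latin_square (2 * m) L"
  shows "latin_square (2 * m) (conjugate m ` L)"
proof -
  have sub: "L \<subseteq> {0..<2 * m} \<times> {0..<2 * m} \<times> {0..<2 * m}"
    and card: "card L = (2 * m)\<^sup>2"
    and cell: "\<And>i j k k'. (i, j, k) \<in> L \<Longrightarrow> (i, j, k') \<in> L \<Longrightarrow> k = k'"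
    and row: "\<And>i j j' k. (i, j, k) \<in> L \<Longrightarrow> (i, j', k) \<in> L \<Longrightarrow> j = j'"
    and col: "\<And>i i' j k. (i, j, k) \<in> L \<Longrightarrow> (i', j, k) \<in> L \<Longrightarrow> i = i'"
    using L unfolding latin_square_def partial_latin_square_def by blast+
  have mem: "(i, flip m k, flip m j) \<in> L \<and> j < 2 * m \<and> k < 2 * m"
    if "(i, j, k) \<in> conjugate m ` L" for i j k
    using that sub by (auto simp: conjugate_def flip_flip flip_less[OF m])
  have inj: "x = y" if "flip m x = flip m y" "x < 2 * m" "y < 2 * m" for x y
    using that flip_flip by metis
  have "inj_on (conjugate m) L"
    by (rule inj_on_inverseI[of _ "conjugate m"]) (use sub conjugate_conjugate in blast)
  then have card': "card (conjugate m ` L) = (2 * m)\<^sup>2"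
    using card by (simp add: card_image)
  show ?thesis
    unfolding latin_square_def partial_latin_square_def
  proof (intro conjI allI impI)
    show "conjugate m ` L \<subseteq> {0..<2 * m} \<times> {0..<2 * m} \<times> {0..<2 * m}"
      using sub by (auto simp: conjugate_def flip_less[OF m])
    show "k = k'" if "(i, j, k) \<in> conjugate m ` L \<and> (i, j, k') \<in> conjugate m ` L" for i j k k'
      using mem[of i j k] mem[of i j k'] row inj that by blast
    show "j = j'" if "(i, j, k) \<in> conjugate m ` L \<and> (i, j', k) \<in> conjugate m ` L" for i j j' k
      using mem[of i j k] mem[of i j' k] cell inj that by blast
    show "i = i'" if "(i, j, k) \<in> conjugate m ` L \<and> (i', j, k) \<in> conjugate m ` L" for i i' j k
      using mem[of i j k] mem[of i' j k] col that by blast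
  qed (fact card')
qed

text \<open>The upper corner, the inserted part of row \<open>m\<close> and the lower wedge are each
  mapped to themselves, \<open>(m, m - 1, 2 * m - 1)\<close> is fixed, and the two entries of the
  last row are interchanged.\<close>

lemma conjugate_crit:
  assumes "3 \<le> m" "t \<in> crit m"
  shows "conjugate m t \<in> crit m"
proof -
  obtain i j k where t: "t = (i, j, k)"
    using prod_cases3 by blast
  consider "i + j + 2 \<le> m" "k = i + j" | "i = m" "j + 1 = m" "k + 1 = 2 * m"
    | "i = m" "m < j" "j + 1 < 2 * m" "k + 1 = j"
    | "m \<le> i" "i + 1 < 2 * m" "3 * m \<le> i + j + 1" "k + 2 * m = i + j" "j < 2 * m"
    | "i + 1 = 2 * m" "j = m" "k + 1 = m" | "i + 1 = 2 * m" "j + 1 = 2 * m" "k + 2 = 2 * m"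
    using assms(2) by (auto simp: t crit_def)
  then show ?thesis
  proof cases
    case 1
    with flip_add(1)[of k m] flip_add(1)[of j m] show ?thesis
      by (auto simp: t conjugate_def crit_def)
  next
    case 2
    with flip_add(2)[of m k] flip_add(2)[of m j] assms(1) show ?thesis
      by (auto simp: t conjugate_def crit_def)
  next
    case 3
    with flip_add(2)[of m k] flip_add(2)[of m j] assms(1) show ?thesis
      by (auto simp: t conjugate_def crit_def)
  next
    case 4
    with flip_add(2)[of m k] flip_add(2)[of m j] assms(1) show ?thesis
      by (auto simp: t conjugate_def crit_def)
  next
    case 5
    with flip_add(2)[of m k] flip_add(2)[of m j] assms(1) show ?thesis
      by (auto simp: t conjugate_def crit_def)
  next
    case 6
    with flip_add(2)[of m k] flip_add(2)[of m j] assms(1) show ?thesis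
      by (auto simp: t conjugate_def crit_def)
  qed
qed

subsection \<open>Necessity of the entries\<close>

definition necessary :: "nat \<Rightarrow> entry \<Rightarrow> bool" where
  "necessary m t \<longleftrightarrow> (\<exists>L L'. latin_square (2 * m) L \<and> latin_square (2 * m) L' \<and> L \<noteq> L' \<and>
     crit m - {t} \<subseteq> L \<and> crit m - {t} \<subseteq> L')"

text \<open>Two squares that witness necessity of the conjugate entry are conjugated back. They stay
  distinct because the conjugation is an involution.\<close>

lemma necessary_conjugate:
  assumes m: "3 \<le> m" and t: "t \<in> crit m" and free: "necessary m (conjugate m t)"
  shows "necessary m t"
proof -
  have crit: "crit m \<subseteq> {0..<2 * m} \<times> {0..<2 * m} \<times> {0..<2 * m}"
    using m by (auto simp: crit_def)
  obtain L L' where L: "latin_square (2 * m) L" "latin_square (2 * m) L'" "L \<noteq> L'"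
    "crit m - {conjugate m t} \<subseteq> L" "crit m - {conjugate m t} \<subseteq> L'"
    using free unfolding necessary_def by blast
  have sub: "M \<subseteq> {0..<2 * m} \<times> {0..<2 * m} \<times> {0..<2 * m}" if "latin_square (2 * m) M" for M
    using that unfolding latin_square_def partial_latin_square_def by blast
  have inv: "conjugate m ` conjugate m ` M = M" if "latin_square (2 * m) M" for M
    using sub[OF that] conjugate_conjugate by (force simp: image_image)
  have *: "crit m - {t} \<subseteq> conjugate m ` M" if "crit m - {conjugate m t} \<subseteq> M" for M
  proof
    fix s assume s: "s \<in> crit m - {t}"
    then have "conjugate m s \<in> crit m" "conjugate m (conjugate m s) = s" "conjugate m (conjugate m t) = t"
      using conjugate_crit[OF m] conjugate_conjugate crit t by blast+
    then have "conjugate m s \<in> M" "s = conjugate m (conjugate m s)"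
      using that s by auto
    then show "s \<in> conjugate m ` M"
      by blast
  qed
  have "conjugate m ` L \<noteq> conjugate m ` L'"
    using L inv by metis
  then show ?thesis
    unfolding necessary_def using L latin_square_conjugate[OF m] * by meson
qed

lemma crit_imp_sq:
  assumes "3 \<le> m" "(i, j, k) \<in> crit m"
  shows "k = sq m i j"
proof -
  consider "i + j + 2 \<le> m" "k = i + j" | "i = m" "j + 1 = m" "k + 1 = 2 * m"
    | "i = m" "m < j" "j + 1 < 2 * m" "k + 1 = j"
    | "m \<le> i" "i + 1 < 2 * m" "3 * m \<le> i + j + 1" "k + 2 * m = i + j" "j < 2 * m"
    | "i + 1 = 2 * m" "j = m" "k + 1 = m" | "i + 1 = 2 * m" "j + 1 = 2 * m" "k + 2 = 2 * m"
    using assms(2) by (auto simp: crit_def)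
  then show ?thesis
    using assms(1) by cases (auto simp: sq_def)
qed

text \<open>Forgets the symbols: whether a trade avoids the other entries of \<open>crit m\<close>
  depends on positions only.\<close>

lemma crit_cell:
  assumes "3 \<le> m" "(i, j, k) \<in> crit m"
  shows "i + j + 2 \<le> m \<or> i = m \<and> j + 1 = m \<or> m \<le> i \<and> i + 1 < 2 * m \<and> 3 * m \<le> i + j + 1
    \<or> i = m \<and> m < j \<or> i + 1 = 2 * m \<and> (j = m \<or> j + 1 = 2 * m)"
  using assms by (auto simp: crit_def)

text \<open>One of the two completions is always \<open>sq m\<close>; the other may differ from it
  at a single cell of \<open>crit m\<close>.\<close>

lemma necessaryI:
  assumes m: "3 \<le> m" and g: "latin_fun (2 * m) g"
    and t: "(i, j, k) \<in> crit m" and neq: "g i j \<noteq> sq m i j"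
    and eq: "\<And>i' j' k'. (i', j', k') \<in> crit m \<Longrightarrow> i' \<noteq> i \<or> j' \<noteq> j \<Longrightarrow> g i' j' = sq m i' j'"
  shows "necessary m (i, j, k)"
proof -
  have bounds: "i' < 2 * m" "j' < 2 * m" if "(i', j', k') \<in> crit m" for i' j' k'
    using that by (auto simp: crit_def)
  have k: "k = sq m i j"
    using crit_imp_sq[OF m t] .
  have "crit m - {(i, j, k)} \<subseteq> graph (2 * m) (sq m)"
    using crit_imp_sq[OF m] bounds by auto
  moreover have "crit m - {(i, j, k)} \<subseteq> graph (2 * m) g"
  proof (rule subsetI)
    fix s assume s: "s \<in> crit m - {(i, j, k)}"
    obtain i' j' k' where s': "s = (i', j', k')"
      using prod_cases3 by blast
    have "k' = sq m i' j'"
      using s s' crit_imp_sq[OF m] by auto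
    then have "i' \<noteq> i \<or> j' \<noteq> j"
      using s s' k by auto
    then show "s \<in> graph (2 * m) g"
      using s s' eq[of i' j' k'] bounds[of i' j' k'] \<open>k' = sq m i' j'\<close> by auto
  qed
  moreover have "graph (2 * m) (sq m) \<noteq> graph (2 * m) g"
  proof -
    have "(i, j, k) \<in> graph (2 * m) (sq m)" "(i, j, k) \<notin> graph (2 * m) g"
      using bounds[OF t] k neq by auto
    then show ?thesis
      by blast
  qed
  ultimately show ?thesis
    unfolding necessary_def using latin_square_graph g latin_fun_sq[OF m] by blast
qed

section \<open>Trades that permute rows within columns\<close>

lemma necessary_permute_rows:
  assumes m: "3 \<le> m" and t: "(i, j, k) \<in> crit m" and R: "R \<subseteq> {..<2 * m}" and T: "T \<subseteq> {..<2 * m}"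
    and same: "\<And>i j. i \<notin> R \<or> j \<notin> T \<Longrightarrow> p j i = i"
    and perm: "\<And>j. j \<in> T \<Longrightarrow> p j ` R = R"
    and rows: "\<And>i. i \<in> R \<Longrightarrow> (\<lambda>j. sq m (p j i) j) ` T = sq m i ` T"
    and moved: "p j i \<noteq> i"
    and only: "\<And>i' j' k'. (i', j', k') \<in> crit m \<Longrightarrow> i' \<in> R \<Longrightarrow> j' \<in> T \<Longrightarrow> p j' i' \<noteq> i' \<Longrightarrow> i' = i \<and> j' = j"
  shows "necessary m (i, j, k)"
proof (rule necessaryI[OF m _ t])
  show "latin_fun (2 * m) (\<lambda>i j. sq m (p j i) j)"
    by (rule latin_fun_permute_rows[OF latin_fun_sq[OF m] R T same perm rows])
  have "i \<in> R" "j \<in> T"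
    using moved same by blast+
  then have "i < 2 * m" "j < 2 * m" "p j i < 2 * m"
    using R T perm by blast+
  \<comment> \<open>A column of \<open>sq m\<close> has no repeated symbol, so taking the entry from
    another row really changes it.\<close>
  then show "sq m (p j i) j \<noteq> sq m i j"
    using latin_funD(3)[OF latin_fun_sq[OF m], of i j "p j i"] moved by metis
  show "sq m (p j' i') j' = sq m i' j'" if "(i', j', k') \<in> crit m" "i' \<noteq> i \<or> j' \<noteq> j" for i' j' k'
    using only[OF that(1)] same[of i' j'] that(2) by metis
qed

text \<open>If two rows carry the same symbols in the columns \<open>S\<close>, exchanging them
  there is a trade. It must meet \<open>crit m\<close> in one cell only.\<close>

lemma necessary_swap_rows:
  assumes m: "3 \<le> m" and t: "(i, j, k) \<in> crit m"
    and i: "i = a \<or> i = b" and j: "j \<in> S" and ab: "a \<noteq> b" "a < 2 * m" "b < 2 * m" and S: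
        "S \<subseteq> {..<2 * m}"
    and eq: "sq m a ` S = sq m b ` S"
    and only: "\<And>i' j' k'. (i', j', k') \<in> crit m \<Longrightarrow> i' = a \<or> i' = b \<Longrightarrow> j' \<in> S \<Longrightarrow> i' = i \<and> j' = j"
  shows "necessary m (i, j, k)"
proof -
  define p where "p = (\<lambda>j x. if j \<in> S \<and> x = a then b else if j \<in> S \<and> x = b then a else x)"
  have p: "p j a = b" "p j b = a" if "j \<in> S" for j
    using that by (auto simp: p_def)
  show ?thesis
  proof (rule necessary_permute_rows[OF m t, where R = "{a, b}" and T = S and p = p])
    show "(\<lambda>j. sq m (p j x) j) ` S = sq m x ` S" if "x \<in> {a, b}" for x
    proof (cases "x = a")
      case True
      have "(\<lambda>j. sq m (p j x) j) ` S = sq m b ` S"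
        by (rule image_cong) (simp_all add: True p)
      then show ?thesis
        using eq True by simp
    next
      case False
      then have "x = b"
        using that by simp
      have "(\<lambda>j. sq m (p j x) j) ` S = sq m a ` S"
        by (rule image_cong) (simp_all add: \<open>x = b\<close> p)
      then show ?thesis
        using eq \<open>x = b\<close> by simp
    qed
    show "p j i \<noteq> i"
      using i j p ab(1) by metis
    show "i' = i \<and> j' = j" if "(i', j', k') \<in> crit m" "i' \<in> {a, b}" "j' \<in> S" for i' j' k'
      using only[OF that(1) _ that(3)] that(2) by blast
  qed (use ab S in \<open>auto simp: p_def\<close>)
qed

text \<open>
  The trade permutes the rows cyclically (\<open>a \<leftarrow> b \<leftarrow> c \<leftarrow> a\<close>) in column \<open>u\<close>, in the opposite
  direction in column \<open>v\<close>, and swaps \<open>a\<close> and \<open>b\<close> in the columns \<open>S\<close>.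
\<close>

lemma necessary_three_rows:
  assumes m: "3 \<le> m" and t: "(c, j, k) \<in> crit m" and j: "j = u \<or> j = v"
    and abc: "a \<noteq> b" "b \<noteq> c" "a \<noteq> c" "a < 2 * m" "b < 2 * m" "c < 2 * m"
    and uv: "u \<noteq> v" "u \<notin> S" "v \<notin> S" "u < 2 * m" "v < 2 * m" "S \<subseteq> {..<2 * m}"
    and eq: "sq m a u = sq m c v" "sq m b v = sq m c u" "sq m a ` insert v S = sq m b ` insert u S"
    and only: "\<And>i' j' k'. (i', j', k') \<in> crit m \<Longrightarrow> (i' = a \<or> i' = b) \<and> (j' = u \<or> j' = v \<or> j' \<in> S)
      \<or> i' = c \<and> (j' = u \<or> j' = v) \<Longrightarrow> i' = c \<and> j' = j"
  shows "necessary m (c, j, k)"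
proof -
  define p where "p = (\<lambda>j x. if j = u then if x = a then b else if x = b then c else if x = c then a else x
    else if j = v then if x = a then c else if x = b then a else if x = c then b else x
    else if j \<in> S then if x = a then b else if x = b then a else x else x)"
  have p: "p u a = b" "p u b = c" "p u c = a" "p v a = c" "p v b = a" "p v c = b"
    and pS: "j \<in> S \<Longrightarrow> p j a = b" "j \<in> S \<Longrightarrow> p j b = a" "j \<in> S \<Longrightarrow> p j c = c" for j
    using abc uv by (auto simp: p_def)
  have S: "(\<lambda>j. sq m (p j a) j) ` S = sq m b ` S" "(\<lambda>j. sq m (p j b) j) ` S = sq m a ` S"
    "(\<lambda>j. sq m (p j c) j) ` S = sq m c ` S"
    by (rule image_cong; simp add: pS)+
  show ?thesis
  proof (rule necessary_permute_rows[OF m t, where R = "{a, b, c}" and T = "insert u (insert v S)"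
      and p = p])
    show "(\<lambda>j. sq m (p j x) j) ` insert u (insert v S) = sq m x ` insert u (insert v S)"
      if x: "x \<in> {a, b, c}" for x
    proof -
      consider "x = a" | "x = b" | "x = c"
        using x by blast
      then show ?thesis
      proof cases
        case 1
        \<comment> \<open>Column \<open>v\<close> returns the symbol \<open>sq m a u\<close> to row
          \<open>a\<close>; the other columns bring the symbols of row \<open>b\<close> on
          \<open>insert u S\<close>, which are those of row \<open>a\<close> on
          \<open>insert v S\<close>.\<close>
        have "(\<lambda>j. sq m (p j x) j) ` insert u (insert v S) = insert (sq m a u) (sq m b ` insert u S)"
          unfolding 1 image_insert p S using eq(1) by auto
        then show ?thesis
          using eq(3) 1 by auto
      next
        case 2
        have "(\<lambda>j. sq m (p j x) j) ` insert u (insert v S) = insert (sq m b v) (sq m a ` insert v S)"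
          unfolding 2 image_insert p S using eq(2) by auto
        then show ?thesis
          using eq(3) 2 by auto
      next
        case 3
        \<comment> \<open>In row \<open>c\<close> the two symbols merely change places.\<close>
        show ?thesis
          unfolding 3 image_insert p S using eq(1,2) by auto
      qed
    qed
    show "p j c \<noteq> c"
      using j p abc by metis
    show "i' = c \<and> j' = j"
      if "(i', j', k') \<in> crit m" "i' \<in> {a, b, c}" "j' \<in> insert u (insert v S)" "p j' i' \<noteq> i'"
          for i' j' k'
      using only[OF that(1)] that(2-) pS(3) by blast
    show "p j ` {a, b, c} = {a, b, c}" if "j \<in> insert u (insert v S)" for j
      using that p pS[of j] by auto
  qed (use abc uv in \<open>auto simp: p_def\<close>)
qed

lemma necessary_intercalate:
  assumes m: "3 \<le> m" and t: "(i, j, k) \<in> crit m" and i: "i = a \<or> i = b" and j: "j = c \<or> j = d"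
    and ab: "a \<noteq> b" "a < 2 * m" "b < 2 * m" and cd: "c < 2 * m" "d < 2 * m"
    and eq: "sq m a c = sq m b d" "sq m a d = sq m b c"
    and only: "\<And>i' j' k'. (i', j', k') \<in> crit m \<Longrightarrow> i' = a \<or> i' = b \<Longrightarrow> j' = c \<or> j' = d \<Longrightarrow> i' = i \<and> j' = j"
  shows "necessary m (i, j, k)"
proof (rule necessary_swap_rows[OF m t i _ ab])
  show "sq m a ` {c, d} = sq m b ` {c, d}"
    using eq by auto
  show "i' = i \<and> j' = j" if "(i', j', k') \<in> crit m" "i' = a \<or> i' = b" "j' \<in> {c, d}" for i' j' k'
    using only[OF that(1,2)] that(3) by blast
qed (use j cd in auto)

section \<open>A trade for each kind of entry\<close>

lemma necessary_first_row:
  assumes "3 \<le> m" "0 < j" "j + 3 \<le> m" "(0, j, k) \<in> crit m"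
  shows "necessary m (0, j, k)"
proof (rule necessary_intercalate[where a = 0 and b = "2 * m - 1" and c = j and d = "j + m"])
  fix i' j' k'
  assume "(i', j', k') \<in> crit m" "i' = 0 \<or> i' = 2 * m - 1" "j' = j \<or> j' = j + m"
  then show "i' = 0 \<and> j' = j"
    using crit_cell[of m i' j' k'] assms by auto
qed (use assms in \<open>auto simp: sq_top sq_last\<close>)

text \<open>The four cells carry only \<open>i + j\<close> and \<open>i + j + m\<close>, as in the
  back circulant square. The bound on \<open>i + j\<close> keeps cell \<open>(i + m, j)\<close> off
  the antidiagonals where \<open>2 * m - 2\<close> and \<open>2 * m - 1\<close> are
  exchanged.\<close>

lemma necessary_corner_interior:
  assumes "3 \<le> m" "0 < i" "0 < j" "i + j + 3 \<le> m" "(i, j, k) \<in> crit m"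
  shows "necessary m (i, j, k)"
proof (rule necessary_intercalate[where a = i and b = "i + m" and c = j and d = "j + m"])
  fix i' j' k'
  assume "(i', j', k') \<in> crit m" "i' = i \<or> i' = i + m" "j' = j \<or> j' = j + m"
  then show "i' = i \<and> j' = j"
    using crit_cell[of m i' j' k'] assms by auto
qed (use assms in \<open>auto simp: sq_top sq_low\<close>)

text \<open>Columns \<open>0\<close> and \<open>m\<close> show \<open>m - 2\<close> and
  \<open>2 * m - 2\<close> in row \<open>m - 2\<close>, and in the opposite order in row
  \<open>m\<close>.\<close>

lemma necessary_corner_bottom:
  assumes "3 \<le> m" "i + 2 = m" "(i, 0, k) \<in> crit m"
  shows "necessary m (i, 0, k)"
proof (rule necessary_intercalate[where a = "i" and b = m and c = 0 and d = m])
  fix i' j' k'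
  assume "(i', j', k') \<in> crit m" "i' = i \<or> i' = m" "j' = 0 \<or> j' = m"
  then show "i' = i \<and> j' = 0"
    using crit_cell[of m i' j' k'] assms by auto
qed (use assms in \<open>auto simp: sq_top sq_m\<close>)

lemma necessary_mid_row:
  assumes "3 \<le> m" "m < j" "j + 1 < 2 * m" "(m, j, k) \<in> crit m"
  shows "necessary m (m, j, k)"
proof (rule necessary_intercalate[where a = "m - 1" and b = m and c = "j - m" and d = j])
  fix i' j' k'
  assume "(i', j', k') \<in> crit m" "i' = m - 1 \<or> i' = m" "j' = j - m \<or> j' = j"
  then show "i' = m \<and> j' = j"
    using crit_cell[of m i' j' k'] assms by auto
qed (use assms in \<open>auto simp: sq_top sq_m\<close>)

lemma necessary_wedge_interior:
  assumes "3 \<le> m" "m < i" "i + 1 < 2 * m" "j + 1 < 2 * m" "3 * m \<le> i + j" "(i, j, k) \<in> crit m"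
  shows "necessary m (i, j, k)"
proof (rule necessary_intercalate[where a = "i - m" and b = i and c = "j - m" and d = j])
  fix i' j' k'
  assume "(i', j', k') \<in> crit m" "i' = i - m \<or> i' = i" "j' = j - m \<or> j' = j"
  then show "i' = i \<and> j' = j"
    using crit_cell[of m i' j' k'] assms by auto
qed (use assms in \<open>auto simp: sq_top sq_low\<close>)

text \<open>Row \<open>h\<close> offers \<open>2 * h\<close> in column \<open>h\<close> and
  \<open>h - 1\<close> in the last column; row \<open>m\<close> has \<open>h - 1\<close> and
  \<open>m - 1\<close> there. The first and last of these match exactly when
  \<open>m = 2 * h + 1\<close>, which is why even \<open>m\<close> needs a larger trade.\<close>

lemma necessary_mid_end_odd:
  assumes "3 \<le> m" "m = 2 * h + 1" "(m, 2 * m - 1, k) \<in> crit m"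
  shows "necessary m (m, 2 * m - 1, k)"
proof (rule necessary_intercalate[where a = h and b = m and c = h and d = "2 * m - 1"])
  fix i' j' k'
  assume "(i', j', k') \<in> crit m" "i' = h \<or> i' = m" "j' = h \<or> j' = 2 * m - 1"
  then show "i' = m \<and> j' = 2 * m - 1"
    using crit_cell[of m i' j' k'] assms by auto
qed (use assms in \<open>auto simp: sq_top sq_m\<close>)

text \<open>Rows \<open>m\<close> and \<open>2 * m - 2\<close> carry the same symbols in the columns
  up to \<open>m\<close>, and every other entry of \<open>crit m\<close> in these rows lies further
  right.\<close>

lemma necessary_mid_extra:
  assumes m: "3 \<le> m" and t: "(m, m - 1, k) \<in> crit m"
  shows "necessary m (m, m - 1, k)"
proof (rule necessary_swap_rows[where a = m and b = "2 * m - 2" and S = "{..m}"])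
  have "sq m m ` {..m} = {..<m - 1} \<union> {2 * m - 2, 2 * m - 1}"
  proof (intro subset_antisym subsetI)
    fix x assume "x \<in> {..<m - 1} \<union> {2 * m - 2, 2 * m - 1}"
    then consider "x + 3 \<le> m" | "x = m - 2" | "x = 2 * m - 2" | "x = 2 * m - 1"
      by force
    then have "x = sq m m (if x + 3 \<le> m then x + 1 else if x = m - 2 then m else if x = 2 * m - 2 then 0 else m - 1)"
      by cases (use m in \<open>auto simp: sq_m\<close>)
    then show "x \<in> sq m m ` {..m}"
      by (rule image_eqI) auto
  qed (use m in \<open>auto simp: sq_m\<close>)
  moreover have "sq m (2 * m - 2) ` {..m} = {..<m - 1} \<union> {2 * m - 2, 2 * m - 1}"
  proof (intro subset_antisym subsetI)
    fix x assume "x \<in> {..<m - 1} \<union> {2 * m - 2, 2 * m - 1}"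
    then consider "x + 4 \<le> m" | "x + 3 = m" | "x = m - 2" | "x = 2 * m - 2" | "x = 2 * m - 1"
      by force
    then have "x = sq m (2 * m - 2) (if x + 4 \<le> m then x + 2 else if x + 3 = m then m else if x = m - 2 then m - 1
        else if x = 2 * m - 2 then 1 else 0)"
      by cases (use m in \<open>auto simp: sq_low\<close>)
    then show "x \<in> sq m (2 * m - 2) ` {..m}"
      by (rule image_eqI) (use m in auto)
  qed (use m in \<open>auto simp: sq_low\<close>)
  ultimately show "sq m m ` {..m} = sq m (2 * m - 2) ` {..m}"
    by simp
  fix i' j' k'
  assume "(i', j', k') \<in> crit m" "i' = m \<or> i' = 2 * m - 2" "j' \<in> {..m}"
  then show "i' = m \<and> j' = m - 1"
    using crit_cell[of m i' j' k'] m by auto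
qed (use m t in auto)

text \<open>Row \<open>m - 1\<close> contains no entry of \<open>crit m\<close>, and leaving column
  \<open>m\<close> out of the exchange protects the other entry of the last row.\<close>

lemma necessary_last_end:
  assumes m: "3 \<le> m" and t: "(2 * m - 1, 2 * m - 1, k) \<in> crit m"
  shows "necessary m (2 * m - 1, 2 * m - 1, k)"
proof (rule necessary_swap_rows[where a = "m - 1" and b = "2 * m - 1" and S =
    "insert (m - 1) {m<..<2 * m}"])
  have "sq m (m - 1) ` insert (m - 1) {m<..<2 * m} = insert (2 * m - 2) {..<m - 1}"
  proof (intro subset_antisym subsetI)
    fix x assume "x \<in> insert (2 * m - 2) {..<m - 1}"
    then have "x = sq m (m - 1) (if x = 2 * m - 2 then m - 1 else x + m + 1)"
      using m by (auto simp: sq_top)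
    then show "x \<in> sq m (m - 1) ` insert (m - 1) {m<..<2 * m}"
      by (rule image_eqI) (use \<open>x \<in> _\<close> in auto)
  qed (use m in \<open>auto simp: sq_top\<close>)
  moreover have "sq m (2 * m - 1) ` insert (m - 1) {m<..<2 * m} = insert (2 * m - 2) {..<m - 1}"
  proof (intro subset_antisym subsetI)
    fix x assume "x \<in> insert (2 * m - 2) {..<m - 1}"
    then have "x = sq m (2 * m - 1) (if x = 2 * m - 2 then 2 * m - 1 else if x = 0 then m - 1 else x + m)"
      using m by (auto simp: sq_last)
    then show "x \<in> sq m (2 * m - 1) ` insert (m - 1) {m<..<2 * m}"
      by (rule image_eqI) (use \<open>x \<in> _\<close> m in auto)
  qed (use m in \<open>auto simp: sq_last\<close>)
  ultimately show "sq m (m - 1) ` insert (m - 1) {m<..<2 * m} = sq m (2 * m - 1) ` insert (m - 1) {m<..<2 * m}"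
    by simp
  fix i' j' k'
  assume "(i', j', k') \<in> crit m" "i' = m - 1 \<or> i' = 2 * m - 1" "j' \<in> insert (m - 1) {m<..<2 * m}"
  then show "i' = 2 * m - 1 \<and> j' = 2 * m - 1"
    using crit_cell[of m i' j' k'] m by auto
qed (use m t in auto)

text \<open>Rows \<open>0\<close> and \<open>1\<close> are exchanged in the right half, which costs
  row \<open>0\<close> the symbol \<open>m\<close> and gives it a second \<open>0\<close>. Exchanges
  with the last row in columns \<open>0\<close> and \<open>m - 1\<close> repair this; in the last
  row \<open>0\<close> and \<open>m\<close> only change places.\<close>

lemma necessary_origin:
  assumes m: "3 \<le> m" and t: "(0, 0, k) \<in> crit m"
  shows "necessary m (0, 0, k)"
proof -
  define p where "p = (\<lambda>j i. if j = 0 then if i = 0 then 2 * m - 1 else if i = 2 * m - 1 then 0 else i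
    else if j = m - 1 then if i = 1 then 2 * m - 1 else if i = 2 * m - 1 then 1 else i
    else if m \<le> j \<and> j < 2 * m then if i = 0 then 1 else if i = 1 then 0 else i else i)"
  define S where "S = {m..<2 * m}"
  have p: "p 0 0 = 2 * m - 1" "p 0 1 = 1" "p 0 (2 * m - 1) = 0"
    "p (m - 1) 0 = 0" "p (m - 1) 1 = 2 * m - 1" "p (m - 1) (2 * m - 1) = 1"
    and pS: "j \<in> S \<Longrightarrow> p j 0 = 1" "j \<in> S \<Longrightarrow> p j 1 = 0" "j \<in> S \<Longrightarrow> p j (2 * m - 1) = 2 * m - 1" for j
    using m by (auto simp: p_def S_def)
  have S: "(\<lambda>j. sq m (p j 0) j) ` S = sq m 1 ` S" "(\<lambda>j. sq m (p j 1) j) ` S = sq m 0 ` S"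
    "(\<lambda>j. sq m (p j (2 * m - 1)) j) ` S = sq m (2 * m - 1) ` S"
    by (rule image_cong; simp add: pS del: One_nat_def)+
  have vals: "sq m 0 0 = 0" "sq m (2 * m - 1) (m - 1) = 0" "sq m (2 * m - 1) 0 = m" "sq m 1 (m - 1) = m"
    using m by (auto simp: sq_top sq_last)
  \<comment> \<open>Row \<open>1\<close> is row \<open>0\<close> shifted cyclically, so over the
    right half they differ only in \<open>m\<close> and \<open>0\<close>.\<close>
  have shift: "insert 0 (sq m 0 ` S) = insert m (sq m 1 ` S)"
  proof -
    have "insert 0 (sq m 0 ` S) = insert 0 {m..<2 * m}"
      using m by (auto simp: S_def sq_top)
    moreover have "insert m (sq m 1 ` S) = insert 0 {m..<2 * m}"
    proof (intro subset_antisym subsetI)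
      fix x assume x: "x \<in> insert 0 {m..<2 * m}"
      show "x \<in> insert m (sq m 1 ` S)"
      proof (cases "x = m")
        case False
        have "x = sq m 1 (if x = 0 then 2 * m - 1 else x - 1)"
          using x m by (auto simp: sq_top)
        then have "x \<in> sq m 1 ` S"
          by (rule image_eqI) (use x False m in \<open>auto simp: S_def\<close>)
        then show ?thesis
          by simp
      qed simp
    qed (use m in \<open>auto simp: sq_top S_def\<close>)
    ultimately show ?thesis
      by simp
  qed
  have shift': "insert m (insert z (sq m 1 ` S)) = insert 0 (insert z (sq m 0 ` S))" for z
    by (simp only: insert_commute[of m z] insert_commute[of 0 z] shift)
  show ?thesis
  proof (rule necessary_permute_rows[OF m t, where R = "{0, 1, 2 * m - 1}" and T =
      "insert 0 (insert (m - 1) S)" and p = p])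
    show "(\<lambda>j. sq m (p j x) j) ` insert 0 (insert (m - 1) S) = sq m x ` insert 0 (insert (m - 1) S)"
      if x: "x \<in> {0, 1, 2 * m - 1}" for x
    proof -
      consider "x = 0" | "x = 1" | "x = 2 * m - 1"
        using x by blast
      then show ?thesis
      proof cases
        case 1
        show ?thesis
          unfolding 1 image_insert p S vals by (rule shift')
      next
        case 2
        show ?thesis
          unfolding 2 image_insert p S vals using shift by auto
      next
        case 3
        show ?thesis
          unfolding 3 image_insert p S vals by auto
      qed
    qed
    show "p j ` {0, 1, 2 * m - 1} = {0, 1, 2 * m - 1}" if j: "j \<in> insert 0 (insert (m - 1) S)" for j
    proof -
      consider "j = 0" | "j = m - 1" | "j \<in> S"
        using j by blast
      then show ?thesis
        by cases (auto simp only: image_insert image_empty p pS)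
    qed
    show "i' = 0 \<and> j' = 0"
      if "(i', j', k') \<in> crit m" "i' \<in> {0, 1, 2 * m - 1}" "j' \<in> insert 0 (insert (m - 1) S)" "p j' i' \<noteq> i'" for i' j' k'
    proof -
      note cell = crit_cell[OF m that(1)]
      have "j' = 0 \<or> j' = m - 1 \<or> m \<le> j' \<and> j' < 2 * m"
        using that(3) by (auto simp: S_def)
      moreover have "i' \<noteq> 1"
      proof
        assume "i' = 1"
        then have "j' = 0"
          using cell calculation m by auto
        then show False
          using that(4) p(2) \<open>i' = 1\<close> by simp
      qed
      moreover have "i' \<noteq> 2 * m - 1"
      proof
        assume i': "i' = 2 * m - 1"
        then have "j' \<in> S"
          using cell m by (auto simp: S_def)
        then show False
          using that(4) pS(3) i' by blast
      qed
      ultimately show ?thesis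
        using cell that(2) m by auto
    qed
  qed (use m in \<open>auto simp: p_def S_def\<close>)
qed

text \<open>The neighbouring rows \<open>m + i\<close> and \<open>m + i + 1\<close> are shifts of
  each other on the left, and their mismatched symbols \<open>m + i\<close> and \<open>i\<close> are
  exactly those of row \<open>i\<close> in columns \<open>0\<close> and \<open>m\<close>.\<close>

lemma necessary_left_col:
  assumes i: "0 < i" "i + 3 \<le> m" and t: "(i, 0, k) \<in> crit m"
  shows "necessary m (i, 0, k)"
proof (rule necessary_three_rows[OF _ t, where a = "m + i" and b = "m + i + 1" and u = 0 and v = m
    and S = "{0<..m - 2}"])
  \<comment> \<open>The shift to the next column jumps from \<open>m - 2\<close> to
    \<open>m\<close>, because below row \<open>m\<close> the columns \<open>m - 1\<close> and
    \<open>m\<close> are exchanged.\<close>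
  have "sq m (m + i + 1) ` insert 0 {0<..m - 2} = (\<lambda>j. sq m (m + i) (if j = m - 2 then m else j + 1)) ` insert 0 {0<..m - 2}"
    by (rule image_cong) (use i in \<open>auto simp: sq_low\<close>)
  also have "\<dots> = sq m (m + i) ` (\<lambda>j. if j = m - 2 then m else j + 1) ` insert 0 {0<..m - 2}"
    by (simp only: image_image)
  also have "(\<lambda>j. if j = m - 2 then m else j + 1) ` insert 0 {0<..m - 2} = insert m {0<..m - 2}"
  proof (intro subset_antisym subsetI)
    fix x assume x: "x \<in> insert m {0<..m - 2}"
    then have "x = (\<lambda>j. if j = m - 2 then m else j + 1) (if x = m then m - 2 else x - 1)"
      using i by auto
    then show "x \<in> (\<lambda>j. if j = m - 2 then m else j + 1) ` insert 0 {0<..m - 2}"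
      by (rule image_eqI) (use x i in auto)
  qed (use i in auto)
  finally show "sq m (m + i) ` insert m {0<..m - 2} = sq m (m + i + 1) ` insert 0 {0<..m - 2}"
    by simp
  fix i' j' k'
  assume c: "(i', j', k') \<in> crit m" and
      "(i' = m + i \<or> i' = m + i + 1) \<and> (j' = 0 \<or> j' = m \<or> j' \<in> {0<..m - 2}) \<or> i' = i \<and> (j' = 0 \<or> j' = m)"
  then show "i' = i \<and> j' = 0"
    using crit_cell[OF _ c] i by auto
qed (use i in \<open>auto simp: sq_top sq_low\<close>)

text \<open>In the upper half, moving one row down and one column to the left keeps the symbol. This
  supplies the two neighbouring rows of the next two trades.\<close>

lemma shift_right:
  assumes "a + 1 < m" "u < 2 * m - 1"
  shows "sq m a ` insert (2 * m - 1) {u<..<2 * m - 1} = sq m (a + 1) ` insert u {u<..<2 * m - 1}"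
proof -
  have u: "insert u {u<..<2 * m - 1} = {u..<2 * m - 1}"
    using assms by auto
  have "insert (2 * m - 1) {u<..<2 * m - 1} = {Suc u..<Suc (2 * m - 1)}"
    using assms by auto
  then have v: "insert (2 * m - 1) {u<..<2 * m - 1} = Suc ` {u..<2 * m - 1}"
    by (simp add: image_Suc_atLeastLessThan)
  show ?thesis
    unfolding u v image_image by (rule image_cong) (use assms in \<open>auto simp: sq_top\<close>)
qed

text \<open>Without a suitable single row, two neighbouring ones are used: \<open>m - 1\<close>
  comes from row \<open>h\<close>, column \<open>h + 1\<close>, and \<open>h\<close> from row
  \<open>h + 1\<close>, column \<open>2 * m - 1\<close>. Row \<open>m\<close> carries these symbols
  in the same two columns, in opposite order.\<close>

lemma necessary_mid_end_even:
  assumes m: "m = 2 * h + 2" "0 < h" and t: "(m, 2 * m - 1, k) \<in> crit m"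
  shows "necessary m (m, 2 * m - 1, k)"
proof (rule necessary_three_rows[OF _ t, where a = h and b = "h + 1" and u = "h + 1" and v =
    "2 * m - 1"
      and S = "{h + 1<..<2 * m - 1}"])
  show "sq m h ` insert (2 * m - 1) {h + 1<..<2 * m - 1} = sq m (h + 1) ` insert (h + 1) {h + 1<..<2 * m - 1}"
    by (rule shift_right) (use m in auto)
  show "sq m h (h + 1) = sq m m (2 * m - 1)" "sq m (h + 1) (2 * m - 1) = sq m m (h + 1)"
    using m by (auto simp: sq_top sq_m)
  fix i' j' k'
  assume c: "(i', j', k') \<in> crit m" and
      "(i' = h \<or> i' = h + 1) \<and> (j' = h + 1 \<or> j' = 2 * m - 1 \<or> j' \<in> {h + 1<..<2 * m - 1})
    \<or> i' = m \<and> (j' = h + 1 \<or> j' = 2 * m - 1)"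
  then show "i' = m \<and> j' = 2 * m - 1"
    using crit_cell[OF _ c] m by auto
qed (use m in auto)

lemma necessary_right_col:
  assumes r: "r + 3 \<le> m" and t: "(m + r + 1, 2 * m - 1, k) \<in> crit m"
  shows "necessary m (m + r + 1, 2 * m - 1, k)"
proof (rule necessary_three_rows[OF _ t, where a = r and b = "r + 1" and u = m and v = "2 * m - 1"
      and S = "{m<..<2 * m - 1}"])
  show "sq m r ` insert (2 * m - 1) {m<..<2 * m - 1} = sq m (r + 1) ` insert m {m<..<2 * m - 1}"
    by (rule shift_right) (use r in auto)
  show "sq m r m = sq m (m + r + 1) (2 * m - 1)" "sq m (r + 1) (2 * m - 1) = sq m (m + r + 1) m"
    using r by (auto simp: sq_top sq_low)
  fix i' j' k'
  assume c: "(i', j', k') \<in> crit m" and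
      "(i' = r \<or> i' = r + 1) \<and> (j' = m \<or> j' = 2 * m - 1 \<or> j' \<in> {m<..<2 * m - 1})
    \<or> i' = m + r + 1 \<and> (j' = m \<or> j' = 2 * m - 1)"
  then show "i' = m + r + 1 \<and> j' = 2 * m - 1"
    using crit_cell[OF _ c] r by auto
qed (use r in auto)

subsection \<open>Uniqueness of the completion\<close>

text \<open>\<open>M\<close> is an arbitrary completion, and the assumptions after
  \<open>latin\<close> are the families of entries of \<open>crit m\<close>. Some are indexed by the
  symbol \<open>k\<close>, since the forcing argument begins symbol by symbol.\<close>

locale completion =
  fixes m :: nat and M :: "nat \<Rightarrow> nat \<Rightarrow> nat"
  assumes m: "3 \<le> m"
    and latin: "latin_fun (2 * m) M"
    and corner: "i + j + 2 \<le> m \<Longrightarrow> M i j = i + j"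
    and mid: "M m (m - 1) = 2 * m - 1"
    and mid_row: "m \<le> k \<Longrightarrow> k + 2 < 2 * m \<Longrightarrow> M m (k + 1) = k"
    and wedge: "m \<le> i \<Longrightarrow> i + 1 < 2 * m \<Longrightarrow> j < 2 * m \<Longrightarrow> m \<le> k + 1 \<Longrightarrow> k + 2 * m = i + j \<Longrightarrow> M i j = k"
    and last_m: "M (2 * m - 1) m = m - 1"
    and last_last: "M (2 * m - 1) (2 * m - 1) = 2 * m - 2"
begin

section \<open>Rules that exclude or force a symbol\<close>

lemma row_neq:
  assumes "M i c = l" "i < 2 * m" "j < 2 * m" "c < 2 * m" "c \<noteq> j"
  shows "M i j \<noteq> l"
  using latin_funD(2)[OF latin, of i j c] assms by auto

lemma col_neq:
  assumes "M r j = l" "i < 2 * m" "j < 2 * m" "r < 2 * m" "r \<noteq> i"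
  shows "M i j \<noteq> l"
  using latin_funD(3)[OF latin, of i j r] assms by auto

text \<open>An injective row with values below \<open>2 * m\<close> contains every symbol, so a
  symbol excluded from all other columns must stand in the remaining one.\<close>

lemma only_place:
  assumes "i < 2 * m" "k < 2 * m" and neq: "\<And>c. c < 2 * m \<Longrightarrow> c \<noteq> j \<Longrightarrow> M i c \<noteq> k"
  shows "M i j = k"
proof -
  have "M i ` {..<2 * m} \<subseteq> {..<2 * m}" "inj_on (M i) {..<2 * m}"
    using latin \<open>i < 2 * m\<close> by (auto simp: latin_fun_def)
  then have "M i ` {..<2 * m} = {..<2 * m}"
    by (intro endo_inj_surj) auto
  then obtain c where "c < 2 * m" "M i c = k"
    using \<open>k < 2 * m\<close> by (metis imageE lessThan_iff)
  then show ?thesis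
    using neq by metis
qed

lemma only_symbol:
  assumes "i < 2 * m" "j < 2 * m" and neq: "\<And>l. l < 2 * m \<Longrightarrow> l \<noteq> k \<Longrightarrow> M i j \<noteq> l"
  shows "M i j = k"
  using latin_funD(1)[OF latin assms(1,2)] neq by metis

section \<open>The upper half, symbol by symbol\<close>

text \<open>The given entries place \<open>k\<close> in every column to the right of
  \<open>k\<close>, always in a lower row. The bounds on that row are for
  \<open>below_symbol\<close>, where it must differ from the row being filled.\<close>

lemma right_of_antidiagonal:
  assumes "m \<le> k + 1" "k + 3 \<le> 2 * m" "k < c" "c < 2 * m"
  obtains r where "m \<le> r" "k < r \<or> r = m" "r < 2 * m" "r + 1 = 2 * m \<longrightarrow> k + 1 = m" "M r c = k"
proof -
  consider "c = k + 1" "k + 1 = m" | "c = k + 1" "m \<le> k" | "k + 2 \<le> c"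
    using assms by linarith
  then show ?thesis
  proof cases
    case 1
    then have "M (2 * m - 1) c = k"
      using last_m by auto
    then show ?thesis
      using that[of "2 * m - 1"] 1 m by simp
  next
    case 2
    then show ?thesis
      using that[of m] mid_row[of k] assms by simp
  next
    case 3
    show ?thesis
    proof (rule that)
      show "M (k + 2 * m - c) c = k"
        using wedge[of "k + 2 * m - c" c k] 3 assms by simp
    qed (use 3 assms in linarith)+
  qed
qed

text \<open>Rows are treated downwards. In row \<open>r\<close>, columns left of
  \<open>k - r\<close> hold smaller symbols, columns between \<open>k - r\<close> and
  \<open>k\<close> have \<open>k\<close> in a higher row, and columns beyond \<open>k\<close> have
  it in the lower half.\<close>

lemma top_step:
  assumes k: "m \<le> k + 1" "k < 2 * m"
    and less: "\<And>k' r. k' < k \<Longrightarrow> m \<le> k' + 1 \<Longrightarrow> r < m \<Longrightarrow> M r (k' - r) = k'"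
    and right: "\<And>c. k < c \<Longrightarrow> c < 2 * m \<Longrightarrow> \<exists>r. m \<le> r \<and> r < 2 * m \<and> M r c = k"
  shows "r < m \<Longrightarrow> M r (k - r) = k"
proof (induction r rule: less_induct)
  case (less r)
  show ?case
  proof (rule only_place)
    fix c assume c: "c < 2 * m" "c \<noteq> k - r"
    then consider "r + c + 2 \<le> m" "r + c < k" | "m \<le> r + c + 1" "r + c < k" | "k < r + c" "c \<le> k" |
        "k < c"
      using less.prems k by linarith
    then show "M r c \<noteq> k"
    proof cases
      case 1
      then show ?thesis
        using corner[of r c] by simp
    next
      case 2
      then show ?thesis
        using assms(3)[of "r + c" r] less.prems by simp
    next
      case 3
      then have "M (k - c) c = k"
        using less.IH[of "k - c"] less.prems by simp
      then show ?thesis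
        by (rule col_neq) (use 3 c less.prems in auto)
    next
      case 4
      then obtain r' where "m \<le> r'" "r' < 2 * m" "M r' c = k"
        using right c by blast
      from this(3) show ?thesis
        by (rule col_neq) (use c less.prems \<open>m \<le> r'\<close> \<open>r' < 2 * m\<close> in auto)
    qed
  qed (use k less.prems in auto)
qed

lemma top_low: "m \<le> k + 1 \<Longrightarrow> k + 3 \<le> 2 * m \<Longrightarrow> r < m \<Longrightarrow> M r (k - r) = k"
proof (induction k arbitrary: r rule: less_induct)
  case (less k)
  show ?case
  proof (rule top_step)
    show "M r (k' - r) = k'" if "k' < k" "m \<le> k' + 1" "r < m" for k' r
      using less.IH that less.prems by simp
    show "\<exists>r. m \<le> r \<and> r < 2 * m \<and> M r c = k" if "k < c" "c < 2 * m" for c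
      by (rule right_of_antidiagonal[of k c]) (use less.prems that in auto)
  qed (use less.prems in auto)
qed

lemma top_symbol: "m \<le> k + 1 \<Longrightarrow> k < 2 * m \<Longrightarrow> r < m \<Longrightarrow> M r (k - r) = k"
proof -
  \<comment> \<open>\<open>right_of_antidiagonal\<close> does not cover the two largest symbols. For
    \<open>2 * m - 2\<close> only column \<open>2 * m - 1\<close> lies to the right, and there the
    last row holds it; for \<open>2 * m - 1\<close> no column is left.\<close>
  have second: "M r (2 * m - 2 - r) = 2 * m - 2" if "r < m" for r
  proof (rule top_step)
    show "M r (k' - r) = k'" if "k' < 2 * m - 2" "m \<le> k' + 1" "r < m" for k' r
      using top_low that by simp
    show "\<exists>r. m \<le> r \<and> r < 2 * m \<and> M r c = 2 * m - 2" if "2 * m - 2 < c" "c < 2 * m" for c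
    proof -
      have "c = 2 * m - 1"
        using that by simp
      then show ?thesis
        using last_last m by (intro exI[of _ "2 * m - 1"]) simp
    qed
  qed (use m that in auto)
  have last: "M r (2 * m - 1 - r) = 2 * m - 1" if "r < m" for r
  proof (rule top_step)
    show "M r (k' - r) = k'" if "k' < 2 * m - 1" "m \<le> k' + 1" "r < m" for k' r
      using top_low[of k' r] second[of r] that by (cases "k' = 2 * m - 2") auto
  qed (use m that in auto)
  assume k: "m \<le> k + 1" "k < 2 * m" "r < m"
  then consider "k + 3 \<le> 2 * m" | "k = 2 * m - 2" | "k = 2 * m - 1"
    by linarith
  then show ?thesis
    by cases (use k top_low second last in auto)
qed

lemma top: "r < m \<Longrightarrow> r + c < 2 * m \<Longrightarrow> M r c = r + c"
  using corner[of r c] top_symbol[of "r + c" r] by (cases "r + c + 2 \<le> m") auto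

section \<open>Large symbols in the lower left\<close>

lemma top_col_neq:
  assumes "m \<le> i" "i < 2 * m" "l < 2 * m" "c \<le> l" "l < c + m"
  shows "M i c \<noteq> l"
  by (rule col_neq[of "l - c"]) (use assms top[of "l - c" c] in auto)

text \<open>For each \<open>k\<close> the last row is settled first, since it blocks column
  \<open>k - m\<close> for the rows above. These follow in increasing order; smaller symbols block
  the cells to the left of the antidiagonal.\<close>

lemma below_symbol:
  assumes k: "m \<le> k" "k + 3 \<le> 2 * m"
  shows "M (2 * m - 1) (k - m) = k \<and> (\<forall>i. m < i \<longrightarrow> i \<le> k \<longrightarrow> M i (k - i) = k)"
  using k
proof (induction k rule: less_induct)
  case (less k)
  note IH = less.IH
  \<comment> \<open>In columns up to \<open>k\<close> the symbol already stands in the upper half;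
    in later columns it is given below.\<close>
  have right: "M i c \<noteq> k" if *: "k < m + c" "c < 2 * m" "i < 2 * m" "m < i" "i \<le> k \<or> i + 1 = 2 * m"
      for c i
  proof (cases "c \<le> k")
    case True
    then show ?thesis
      using top_col_neq[of i k c] * less.prems by auto
  next
    case False
    obtain r where "m \<le> r" "k < r \<or> r = m" "r < 2 * m" "r + 1 = 2 * m \<longrightarrow> k + 1 = m" "M r c = k"
      by (rule right_of_antidiagonal[OF _ _ _ *(2)]) (use less.prems False in auto)
    from this(5) show ?thesis
      by (rule col_neq) (use * less.prems \<open>k < r \<or> r = m\<close> \<open>r < 2 * m\<close> \<open>r + 1 = 2 * m \<longrightarrow> k + 1 = m\<close> in auto)
  qed
  have last: "M (2 * m - 1) (k - m) = k"
  proof (rule only_place)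
    fix c assume c: "c < 2 * m" "c \<noteq> k - m"
    show "M (2 * m - 1) c \<noteq> k"
    proof (cases "m + c < k")
      case True
      then have "M (2 * m - 1) c = m + c"
        using less.IH[of "m + c"] less.prems by simp
      then show ?thesis
        using True by simp
    next
      case False
      then show ?thesis
        using right[of c "2 * m - 1"] c less.prems by auto
    qed
  qed (use less.prems in auto)
  have "M i (k - i) = k" if "m < i" "i \<le> k" for i
    using that
  proof (induction i rule: less_induct)
    case (less i)
    note k = \<open>m \<le> k\<close> \<open>k + 3 \<le> 2 * m\<close>
    show ?case
    proof (rule only_place)
      fix c assume c: "c < 2 * m" "c \<noteq> k - i"
      consider "i + c < k" | "k < i + c" "c + m < k" | "c + m = k" | "k < m + c"
        using c less.prems by linarith
      then show "M i c \<noteq> k"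
      proof cases
        case 1
        then have "M i c = i + c"
          using conjunct2[OF IH[of "i + c"], rule_format, of i] less.prems k by simp
        then show ?thesis
          using 1 by simp
      next
        case 2
        then have "M (k - c) c = k"
          using less.IH[of "k - c"] less.prems by simp
        then show ?thesis
          by (rule col_neq) (use 2 c less.prems k in auto)
      next
        case 3
        then have "M (2 * m - 1) c = k"
          using last by auto
        then show ?thesis
          by (rule col_neq) (use 3 c less.prems k in auto)
      next
        case 4
        then show ?thesis
          using right[of c i] c less.prems k by auto
      qed
    qed (use less.prems k in auto)
  qed
  then show ?case
    using last by blast
qed

lemma last_left: "c + 3 \<le> m \<Longrightarrow> M (2 * m - 1) c = m + c"
  using below_symbol[of "m + c"] by simp

lemma below_left: "m < i \<Longrightarrow> i + c + 3 \<le> 2 * m \<Longrightarrow> M i c = i + c"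
  using conjunct2[OF below_symbol[of "i + c"], rule_format, of i] by simp

lemma last_m_2: "M (2 * m - 1) (m - 2) = 2 * m - 1"
proof (rule only_place)
  fix c assume c: "c < 2 * m" "c \<noteq> m - 2"
  then consider "c + 3 \<le> m" | "c = m - 1" | "m \<le> c"
    by linarith
  then show "M (2 * m - 1) c \<noteq> 2 * m - 1"
  proof cases
    case 1
    then show ?thesis
      using last_left m by simp
  next
    case 2
    then show ?thesis
      using col_neq[OF mid, of "2 * m - 1"] m by simp
  next
    case 3
    then show ?thesis
      using top_col_neq[of "2 * m - 1" "2 * m - 1" c] c m by simp
  qed
qed (use m in auto)

text \<open>This comes before the placement of \<open>2 * m - 2\<close> because it fills the
  antidiagonal \<open>i + d = 2 * m - 2\<close>, which must be closed to that symbol.\<close>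

lemma below_last_symbol: "m < i \<Longrightarrow> i + d + 2 = 2 * m \<Longrightarrow> M i d = 2 * m - 1"
proof (induction i arbitrary: d rule: less_induct)
  case (less i d)
  show ?case
  proof (rule only_place)
    fix c assume c: "c < 2 * m" "c \<noteq> d"
    then consider "i + c + 3 \<le> 2 * m" | "2 * m - 2 < i + c" "c + 3 \<le> m" | "c = m - 2" | "c = m - 1"
        | "m \<le> c"
      using less.prems by linarith
    then show "M i c \<noteq> 2 * m - 1"
    proof cases
      case 1
      then show ?thesis
        using below_left less.prems by simp
    next
      case 2
      then have "M (2 * m - 2 - c) c = 2 * m - 1"
        using less.IH[of "2 * m - 2 - c" c] less.prems by simp
      then show ?thesis
        by (rule col_neq) (use 2 c less.prems in auto)
    next
      case 3
      then show ?thesis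
        using col_neq[OF last_m_2, of i] less.prems by simp
    next
      case 4
      then show ?thesis
        using col_neq[OF mid, of i] less.prems by simp
    next
      case 5
      then show ?thesis
        using top_col_neq[of i "2 * m - 1" c] c less.prems by simp
    qed
  qed (use less.prems in auto)
qed

lemma second_last_symbol_right:
  assumes "m \<le> i" "i + 1 < 2 * m" "m \<le> c + 1" "c < 2 * m"
  shows "M i c \<noteq> 2 * m - 2"
proof (cases "c = 2 * m - 1")
  case True
  then show ?thesis
    using col_neq[OF last_last, of i] assms by simp
next
  case False
  then show ?thesis
    using top_col_neq[of i "2 * m - 2" c] assms m by simp
qed

lemma below_second_last_symbol:
  "m < i \<Longrightarrow> i + 1 < 2 * m \<Longrightarrow> i + d + 1 = 2 * m \<Longrightarrow> M i d = 2 * m - 2"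
proof (induction i arbitrary: d rule: less_induct)
  case (less i d)
  show ?case
  proof (rule only_place)
    fix c assume c: "c < 2 * m" "c \<noteq> d"
    then consider "i + c + 3 \<le> 2 * m" | "i + c + 2 = 2 * m" | "2 * m - 1 < i + c" "c + 2 \<le> m" |
        "m \<le> c + 1"
      using less.prems by linarith
    then show "M i c \<noteq> 2 * m - 2"
    proof cases
      case 1
      then show ?thesis
        using below_left less.prems by simp
    next
      case 2
      then show ?thesis
        using below_last_symbol[of i c] less.prems by simp
    next
      case 3
      then have "M (2 * m - 1 - c) c = 2 * m - 2"
        using less.IH[of "2 * m - 1 - c" c] less.prems by simp
      then show ?thesis
        by (rule col_neq) (use 3 c less.prems in auto)
    next
      case 4
      then show ?thesis
        using second_last_symbol_right c less.prems by simp
    qed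
  qed (use less.prems in auto)
qed

lemma mid_0: "M m 0 = 2 * m - 2"
proof (rule only_place)
  fix c assume c: "c < 2 * m" "c \<noteq> 0"
  show "M m c \<noteq> 2 * m - 2"
  proof (cases "c + 2 \<le> m")
    case True
    then have "M (2 * m - 1 - c) c = 2 * m - 2"
      using below_second_last_symbol[of "2 * m - 1 - c" c] c by simp
    then show ?thesis
      by (rule col_neq) (use True c m in auto)
  next
    case False
    then show ?thesis
      using second_last_symbol_right[of m c] c m by simp
  qed
qed (use m in auto)

section \<open>The left columns\<close>

text \<open>All symbols from \<open>j\<close> on already occur in column \<open>j\<close>, so its
  cells in row \<open>m\<close> and in the wrapped rows have only \<open>0\<close> to
  \<open>j - 1\<close> to choose from.\<close>

lemma left_col_large:
  assumes j: "0 < j" "j + 2 \<le> m" and l: "j \<le> l" "l < 2 * m"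
  obtains r where "r < 2 * m" "r \<noteq> m" "r + j < 2 * m \<or> r = 2 * m - 1" "M r j = l"
proof -
  consider "l < j + m" | "l = j + m" "j + 3 \<le> m" | "j + m < l" "l + 3 \<le> 2 * m" |
      "l = 2 * m - 2" "j + 2 = m"
    | "l = 2 * m - 2" | "l = 2 * m - 1" "j + 2 = m" | "l = 2 * m - 1" "j + 3 \<le> m"
    using assms by linarith
  then show ?thesis
  proof cases
    case 1
    then show ?thesis
      using that[of "l - j"] top[of "l - j" j] l by simp
  next
    case 2
    then show ?thesis
      using that[of "2 * m - 1"] last_left[of j] m by (simp add: add.commute)
  next
    case 3
    then show ?thesis
      using that[of "l - j"] below_left[of "l - j" j] by simp
  next
    case 4
    then show ?thesis
      using that[of "2 * m - 1 - j"] below_second_last_symbol[of "2 * m - 1 - j" j] j by auto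
  next
    case 5
    then show ?thesis
      using that[of "2 * m - 1 - j"] below_second_last_symbol[of "2 * m - 1 - j" j] j by auto
  next
    case 6
    then have "j = m - 2"
      by simp
    then show ?thesis
      using 6 that[of "2 * m - 1"] last_m_2 m by simp
  next
    case 7
    then show ?thesis
      using that[of "2 * m - 2 - j"] below_last_symbol[of "2 * m - 2 - j" j] j by auto
  qed
qed

text \<open>Columns go from left to right. In each, row \<open>m\<close> is forced by the earlier
  columns of that row, and the wrapped rows follow from the bottom up.\<close>

lemma left_cols:
  assumes "0 < j" "j + 2 \<le> m"
  shows "M m j = j - 1 \<and> (\<forall>i. 2 * m \<le> i + j \<longrightarrow> i + 2 \<le> 2 * m \<longrightarrow> M i j = i + j - 2 * m)"
  using assms
proof (induction j rule: less_induct)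
  case (less j)
  note j = \<open>0 < j\<close> \<open>j + 2 \<le> m\<close> and IH = less.IH
  have large: "M i j \<noteq> l" if *: "i = m \<or> 2 * m \<le> i + j \<and> i + 2 \<le> 2 * m" "j \<le> l" "l < 2 * m" for i l
  proof -
    obtain r where r: "r < 2 * m" "r \<noteq> m" "r + j < 2 * m \<or> r = 2 * m - 1" "M r j = l"
      by (rule left_col_large[OF j *(2,3)])
    from r(4) show ?thesis
      by (rule col_neq) (use r * j in auto)
  qed
  have row_m: "M m j = j - 1"
  proof (rule only_symbol)
    fix l assume l: "l < 2 * m" "l \<noteq> j - 1"
    show "M m j \<noteq> l"
    proof (cases "j \<le> l")
      case True
      then show ?thesis
        using large[of m l] l by simp
    next
      case False
      then have "M m (l + 1) = l"
        using IH[of "l + 1"] j l by simp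
      then show ?thesis
        by (rule row_neq) (use False l j in auto)
    qed
  qed (use j in auto)
  \<comment> \<open>\<open>q\<close> counts rows from the bottom. It starts at \<open>2\<close>
    because the last row is already filled, and \<open>j - 1\<close>, the value for
    \<open>q = 1\<close>, has gone to row \<open>m\<close>.\<close>
  have "M (2 * m - q) j = j - q" if "2 \<le> q" "q \<le> j" for q
    using that
  proof (induction q rule: less_induct)
    case (less q)
    show ?case
    proof (rule only_symbol)
      fix l assume l: "l < 2 * m" "l \<noteq> j - q"
      then consider "j \<le> l" | "l = j - 1" | "j < l + q" "l + 1 < j" | "l + q < j"
        using less.prems by linarith
      then show "M (2 * m - q) j \<noteq> l"
      proof cases
        case 1
        then show ?thesis
          by (intro large disjI2 conjI) (use l less.prems in linarith)+
      next
        case 2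
        then show ?thesis
          using col_neq[OF row_m, of "2 * m - q"] less.prems j by simp
      next
        case 3
        then have "M (2 * m - (j - l)) j = l"
          using less.IH[of "j - l"] less.prems by simp
        then show ?thesis
          by (rule col_neq) (use 3 l less.prems j in auto)
      next
        case 4
        then have "M (2 * m - q) (l + q) = l"
          using IH[of "l + q"] less.prems j by simp
        then show ?thesis
          by (rule row_neq) (use 4 l less.prems j in auto)
      qed
    qed (use less.prems j in auto)
  qed
  note * = this
  have "M i j = i + j - 2 * m" if "2 * m \<le> i + j" "i + 2 \<le> 2 * m" for i
  proof -
    have "M (2 * m - (2 * m - i)) j = j - (2 * m - i)"
      using that by (intro *) linarith+
    then show ?thesis
      using that by simp
  qed
  then show ?case
    using row_m by blast
qed

lemma mid_left: "k + 3 \<le> m \<Longrightarrow> M m (k + 1) = k"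
  using left_cols[of "k + 1"] by simp

lemma below_wrap: "i < 2 * m - 1 \<Longrightarrow> c + 2 \<le> m \<Longrightarrow> 2 * m + k = i + c \<Longrightarrow> M i c = k"
  using left_cols[of c] by (cases "c = 0") auto

section \<open>The two middle columns\<close>

lemma mid_m: "M m m = m - 2"
proof (rule only_symbol)
  fix l assume l: "l < 2 * m" "l \<noteq> m - 2"
  then consider "l + 3 \<le> m" | "l + 1 = m" | "m \<le> l" "l + 2 < 2 * m" | "l = 2 * m - 2" |
      "l = 2 * m - 1"
    by linarith
  then show "M m m \<noteq> l"
  proof cases
    case 1
    then show ?thesis
      using row_neq[OF mid_left[OF 1]] by simp
  next
    case 2
    then have "M m (2 * m - 1) = l"
      using wedge[of m "2 * m - 1" l] m by simp
    then show ?thesis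
      by (rule row_neq) (use m in auto)
  next
    case 3
    then show ?thesis
      using row_neq[OF mid_row[OF 3]] by simp
  next
    case 4
    then show ?thesis
      using row_neq[OF mid_0] m by simp
  next
    case 5
    then show ?thesis
      using row_neq[OF mid] m by simp
  qed
qed (use m in auto)

text \<open>These symbols already stand in the left columns or in the wedge, so the gap between has
  only \<open>i - m - 1\<close> to \<open>m - 2\<close> to receive.\<close>

lemma below_row_large:
  assumes i: "m < i" "i + 1 < 2 * m" and l: "l < 2 * m" "m \<le> l + 1 \<or> l + m + 2 \<le> i"
  obtains c where "c < 2 * m" "c + 2 \<le> m \<or> 3 * m \<le> i + c + 1" "M i c = l"
proof -
  consider "i \<le> l" "l + 3 \<le> 2 * m" | "l = 2 * m - 2" | "l = 2 * m - 1" | "l < i" "m \<le> l + 1" |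
      "l + m + 2 \<le> i"
    using assms by linarith
  then show ?thesis
  proof cases
    case 1
    then show ?thesis
      using that[of "l - i"] below_left[of i "l - i"] i by simp
  next
    case 2
    then show ?thesis
      using that[of "2 * m - 1 - i"] below_second_last_symbol[of i "2 * m - 1 - i"] i by auto
  next
    case 3
    show ?thesis
    proof (rule that)
      show "M i (2 * m - 2 - i) = l"
        using below_last_symbol[of i "2 * m - 2 - i"] 3 i by simp
    qed (use i in linarith)+
  next
    case 4
    then show ?thesis
      using that[of "l + 2 * m - i"] wedge[of i "l + 2 * m - i" l] i by simp
  next
    case 5
    then show ?thesis
      using that[of "l + 2 * m - i"] below_wrap[of i "l + 2 * m - i" l] i by simp
  qed
qed

text \<open>Rows go from the bottom up. Column \<open>m\<close> comes first in each row: there row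
  \<open>m\<close> blocks \<open>m - 2\<close>, and the rows below block the other larger
  candidates. Its symbol is then excluded from column \<open>m - 1\<close>.\<close>

lemma below_middle:
  assumes "m < i" "i + 1 < 2 * m"
  shows "M i m = i - m - 1 \<and> M i (m - 1) = i - m"
proof -
  have "M (2 * m - q) m = m - q - 1 \<and> M (2 * m - q) (m - 1) = m - q" if "2 \<le> q" "q < m" for q
    using that
  proof (induction q rule: less_induct)
    case (less q)
    define i where "i = 2 * m - q"
    have i: "m < i" "i + 1 < 2 * m" "q = 2 * m - i"
      using less.prems by (auto simp: i_def)
    have IH: "M r m = r - m - 1 \<and> M r (m - 1) = r - m" if "i < r" "r + 1 < 2 * m" for r
      using less.IH[of "2 * m - r"] that i by simp
    have large: "M i j \<noteq> l" if *: "j = m - 1 \<or> j = m" "l < 2 * m" "m \<le> l + 1 \<or> l + m + 2 \<le> i"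
        for j l
    proof -
      obtain c where c: "c < 2 * m" "c + 2 \<le> m \<or> 3 * m \<le> i + c + 1" "M i c = l"
        by (rule below_row_large[OF i(1,2) *(2,3)])
      from c(3) show ?thesis
        by (rule row_neq) (use c * i m in auto)
    qed
    have 1: "M i m = i - m - 1"
    proof (rule only_symbol)
      fix l assume l: "l < 2 * m" "l \<noteq> i - m - 1"
      then consider "m \<le> l + 1 \<or> l + m + 2 \<le> i" | "l = m - 2" | "i < l + m + 1" "l + 3 \<le> m"
        by linarith
      then show "M i m \<noteq> l"
      proof cases
        case 1
        then show ?thesis
          using large[of m l] l by simp
      next
        case 2
        then show ?thesis
          using col_neq[OF mid_m, of i] i by simp
      next
        case 3
        then have "M (l + m + 1) m = l"
          using IH[of "l + m + 1"] by simp
        then show ?thesis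
          by (rule col_neq) (use 3 i in auto)
      qed
    qed (use i in auto)
    have "M i (m - 1) = i - m"
    proof (rule only_symbol)
      fix l assume l: "l < 2 * m" "l \<noteq> i - m"
      then consider "m \<le> l + 1 \<or> l + m + 2 \<le> i" | "l = i - m - 1" | "i < l + m" "l + 2 \<le> m"
        by linarith
      then show "M i (m - 1) \<noteq> l"
      proof cases
        case 1
        then show ?thesis
          using large[of "m - 1" l] l by simp
      next
        case 2
        then show ?thesis
          using row_neq[OF \<open>M i m = i - m - 1\<close>, of "m - 1"] i by simp
      next
        case 3
        then have "M (l + m) (m - 1) = l"
          using IH[of "l + m"] by simp
        then show ?thesis
          by (rule col_neq) (use 3 i in auto)
      qed
    qed (use i in auto)
    with 1 show ?case
      unfolding i_def using less.prems by simp
  qed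
  from this[of "2 * m - i"] show ?thesis
    using assms by simp
qed

lemma last_m_1: "M (2 * m - 1) (m - 1) = 0"
proof (rule only_symbol)
  fix l assume l: "l < 2 * m" "l \<noteq> 0"
  then consider "l + 2 \<le> m" | "m \<le> l + 1" "l + 1 < 2 * m" | "l = 2 * m - 1"
    by linarith
  then show "M (2 * m - 1) (m - 1) \<noteq> l"
  proof cases
    case 1
    then have "M (l + m) (m - 1) = l"
      using below_middle[of "l + m"] l by simp
    then show ?thesis
      by (rule col_neq) (use 1 in auto)
  next
    case 2
    then show ?thesis
      using top_col_neq[of "2 * m - 1" l "m - 1"] m by simp
  next
    case 3
    then show ?thesis
      using col_neq[OF mid, of "2 * m - 1"] m by simp
  qed
qed (use m in auto)

section \<open>The right columns\<close>

text \<open>All symbols from \<open>m - 1\<close> on already occur in column \<open>j\<close>,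
  outside the cells that \<open>right_cols\<close> fills.\<close>

lemma right_col_large:
  assumes j: "m < j" "j < 2 * m" and l: "m \<le> l + 1" "l < 2 * m"
  obtains r where "r < 2 * m" "r < m \<and> r + j < 2 * m \<or> r = m \<or> m < r \<and> 3 * m \<le> r + j + 1" "r = 2 * m - 1 \<longrightarrow> j = 2 * m - 1"
    "M r j = l"
proof -
  consider "j \<le> l" | "l + 1 = j" "j + 1 < 2 * m" | "l + 1 = j" "j = 2 * m - 1" | "l + 2 \<le> j"
    using j by linarith
  then show ?thesis
  proof cases
    case 1
    show ?thesis
    proof (rule that)
      show "M (l - j) j = l"
        using top[of "l - j" j] 1 j l by simp
    qed (use 1 j l in linarith)+
  next
    case 2
    then show ?thesis
      using that[of m] mid_row[of l] j by auto
  next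
    case 3
    show ?thesis
    proof (rule that)
      have "l = 2 * m - 2"
        using 3 m by linarith
      then show "M (2 * m - 1) j = l"
        using last_last 3 by simp
    qed (use 3 j in linarith)+
  next
    case 4
    show ?thesis
    proof (rule that)
      show "M (l + 2 * m - j) j = l"
        using wedge[of "l + 2 * m - j" j l] 4 j l by auto
    qed (use 4 j l in linarith)+
  qed
qed

text \<open>Columns go from left to right. Within a column the gap above the wedge comes first, then
  the last row, then the wrapped cells of the upper half, each using the symbols just
  placed.\<close>

lemma right_cols:
  assumes "m < j" "j < 2 * m"
  shows "(\<forall>i. m < i \<longrightarrow> i + j + 2 \<le> 3 * m \<longrightarrow> M i j = i + j - 2 * m)
     \<and> (j + 1 < 2 * m \<longrightarrow> M (2 * m - 1) j = j - m)
     \<and> (\<forall>i<m. 2 * m \<le> i + j \<longrightarrow> M i j = i + j - 2 * m)"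
  using assms
proof (induction j rule: less_induct)
  case (less j)
  note j = \<open>m < j\<close> \<open>j < 2 * m\<close> and IH = less.IH
  have large: "M i j \<noteq> l"
    if *: "m \<le> l + 1" "l < 2 * m"
      "m < i \<and> i + j + 2 \<le> 3 * m \<or> i = 2 * m - 1 \<and> j + 1 < 2 * m \<or> i < m \<and> 2 * m \<le> i + j" for i l
  proof -
    obtain r where r: "r < 2 * m" "r < m \<and> r + j < 2 * m \<or> r = m \<or> m < r \<and> 3 * m \<le> r + j + 1"
      "r = 2 * m - 1 \<longrightarrow> j = 2 * m - 1" "M r j = l"
      by (rule right_col_large[OF j *(1,2)])
    from r(4) show ?thesis
      by (rule col_neq) (use r * j in auto)
  qed
  \<comment> \<open>\<open>q = 1\<close> would be the edge of the wedge with the given symbol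
    \<open>m - 1\<close>; increasing \<open>q\<close> moves upwards from there.\<close>
  have "M (3 * m - j - q) j = m - q" if "2 \<le> q" "q + j < 2 * m" for q
    using that
  proof (induction q rule: less_induct)
    case (less q)
    define i where "i = 3 * m - j - q"
    have i: "m < i" "i + j + 2 \<le> 3 * m" "i + j + q = 3 * m" "i + 1 < 2 * m"
      using less.prems j by (auto simp: i_def)
    have "M i j = m - q"
    proof (rule only_symbol)
      fix l assume l: "l < 2 * m" "l \<noteq> m - q"
      then consider "m \<le> l + 1" | "m < l + q" "l + 2 \<le> m" | "i < l + m" "l + q < m"
        | "l = i - m" "l + q < m" | "l = i - m - 1" | "l + m + 2 \<le> i"
        using i j by linarith
      then show "M i j \<noteq> l"
      proof cases
        case 1
        then show ?thesis
          using large[of l i] l i by simp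
      next
        case 2
        then have "M (3 * m - j - (m - l)) j = l"
          using less.IH[of "m - l"] less.prems by simp
        then show ?thesis
          by (rule col_neq) (use 2 i j in auto)
      next
        case 3
        then have "M i (l + 2 * m - i) = l"
          using IH[of "l + 2 * m - i"] i j by simp
        then show ?thesis
          by (rule row_neq) (use 3 i j in auto)
      next
        case 4
        then have "M i (m - 1) = l"
          using below_middle[of i] i by simp
        then show ?thesis
          by (rule row_neq) (use i j in auto)
      next
        case 5
        then have "M i m = l"
          using below_middle[of i] i by simp
        then show ?thesis
          by (rule row_neq) (use i j in auto)
      next
        case 6
        then obtain c where c: "c < 2 * m" "c + 2 \<le> m \<or> 3 * m \<le> i + c + 1" "M i c = l"
          by (rule below_row_large[OF i(1,4) l(1) disjI2])
        from c(3) show ?thesis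
          by (rule row_neq) (use c i j in auto)
      qed
    qed (use i j in auto)
    then show ?case
      by (simp add: i_def)
  qed
  note * = this
  have below: "M i j = i + j - 2 * m" if "m < i" "i + j + 2 \<le> 3 * m" for i
    using *[of "3 * m - i - j"] that j by simp
  have last: "M (2 * m - 1) j = j - m" if j': "j + 1 < 2 * m"
  proof (rule only_symbol)
    fix l assume l: "l < 2 * m" "l \<noteq> j - m"
    then consider "m \<le> l + 1" | "j < l + m" "l + 2 \<le> m" | "l = 0" | "0 < l" "l + m < j"
      using j by linarith
    then show "M (2 * m - 1) j \<noteq> l"
    proof cases
      case 1
      then show ?thesis
        using large[of l "2 * m - 1"] l j' by simp
    next
      case 2
      then have "M (l + 2 * m - j) j = l"
        using below[of "l + 2 * m - j"] j by simp
      then show ?thesis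
        by (rule col_neq) (use 2 j in auto)
    next
      case 3
      then show ?thesis
        using row_neq[OF last_m_1, of j] j by simp
    next
      case 4
      then have "M (2 * m - 1) (l + m) = l"
        using IH[of "l + m"] j by simp
      then show ?thesis
        by (rule row_neq) (use 4 j in auto)
    qed
  qed (use j in auto)
  \<comment> \<open>Again upwards, starting in row \<open>m - 1\<close>. The symbols from
    \<open>j - m\<close> to \<open>m - 2\<close> have by now been used in the lower half of the
    column.\<close>
  have "M (m - q) j = j - m - q" if "0 < q" "q + m \<le> j" for q
    using that
  proof (induction q rule: less_induct)
    case (less q)
    define r where "r = m - q"
    have r: "r < m" "2 * m \<le> r + j" "r + q = m" "q \<le> m"
      using less.prems j by (auto simp: r_def)
    have "M r j = j - m - q"
    proof (rule only_symbol)
      fix l assume l: "l < 2 * m" "l \<noteq> j - m - q"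
      then consider "m \<le> l + 1" | "j < l + m" "l + 2 \<le> m" | "l + m = j" "l + 2 \<le> m" |
          "j < l + m + q" "l + m < j" | "l + m + q < j"
        using j by linarith
      then show "M r j \<noteq> l"
      proof cases
        case 1
        then show ?thesis
          using large[of l r] l r by simp
      next
        case 2
        then have "M (l + 2 * m - j) j = l"
          using below[of "l + 2 * m - j"] j by simp
        then show ?thesis
          by (rule col_neq) (use 2 r j in auto)
      next
        case 3
        then have "M (2 * m - 1) j = l"
          using last j by auto
        then show ?thesis
          by (rule col_neq) (use r j in auto)
      next
        case 4
        then have "M (m - (j - m - l)) j = l"
          using less.IH[of "j - m - l"] less.prems by simp
        then show ?thesis
          by (rule col_neq) (use 4 r j in auto)
      next
        case 5
        then have "M r (l + 2 * m - r) = l"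
          using IH[of "l + 2 * m - r"] r j by simp
        then show ?thesis
          by (rule row_neq) (use 5 r j in auto)
      qed
    qed (use r j in auto)
    then show ?case
      by (simp add: r_def)
  qed
  note * = this
  have "M i j = i + j - 2 * m" if "i < m" "2 * m \<le> i + j" for i
    using *[of "m - i"] that j by simp
  then show ?case
    using below last by blast
qed

theorem eq_sq:
  assumes "i < 2 * m" "j < 2 * m"
  shows "M i j = sq m i j"
  using assms(1)
proof (cases rule: row_cases)
  case 1
  show ?thesis
  proof (cases "i + j < 2 * m")
    case True
    then show ?thesis
      using 1 top by (simp add: sq_top)
  next
    case False
    then have "m < j"
      using 1 by linarith
    then show ?thesis
      using 1 False right_cols[OF _ assms(2)] by (simp add: sq_top)
  qed
next
  case 2
  consider "j = 0" | "0 < j" "j + 2 \<le> m" | "j = m - 1" | "j = m" | "m < j" "j + 1 < 2 * m" |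
      "j = 2 * m - 1"
    using assms(2) by linarith
  then show ?thesis
  proof cases
    case 1
    then show ?thesis
      using 2 mid_0 by (simp add: sq_m)
  next
    case case2: 2
    then show ?thesis
      using 2 left_cols[of j] by (simp add: sq_m)
  next
    case 3
    then show ?thesis
      using 2 mid m by (simp add: sq_m)
  next
    case 4
    then show ?thesis
      using 2 mid_m m by (simp add: sq_m)
  next
    case 5
    then show ?thesis
      using 2 mid_row[of "j - 1"] by (simp add: sq_m)
  next
    case 6
    then show ?thesis
      using 2 wedge[of m "2 * m - 1" "m - 1"] m by (simp add: sq_m)
  qed
next
  case 3
  consider "i + j + 3 \<le> 2 * m" | "i + j + 2 = 2 * m" | "i + j + 1 = 2 * m" |
      "2 * m \<le> i + j" "j + 2 \<le> m" | "j = m - 1" | "j = m"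
    | "m < j" "i + j + 2 \<le> 3 * m" | "3 * m \<le> i + j + 1"
    by linarith
  then show ?thesis
  proof cases
    case 1
    then show ?thesis
      using 3 below_left[of i j] by (simp add: sq_low)
  next
    case 2
    then show ?thesis
      using 3 below_last_symbol[of i j] by (simp add: sq_low)
  next
    case case3: 3
    then show ?thesis
      using 3 below_second_last_symbol[of i j] by (simp add: sq_low)
  next
    case 4
    then show ?thesis
      using 3 below_wrap[of i j "i + j - 2 * m"] by (simp add: sq_low)
  next
    case 5
    then show ?thesis
      using 3 below_middle[of i] by (simp add: sq_low)
  next
    case 6
    then show ?thesis
      using 3 below_middle[of i] by (simp add: sq_low)
  next
    case 7
    then show ?thesis
      using 3 right_cols[of j] assms by (simp add: sq_low)
  next
    case 8
    then show ?thesis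
      using 3 wedge[of i j "i + j - 2 * m"] assms by (simp add: sq_low)
  qed
next
  case 4
  then have i: "i = 2 * m - 1"
    by simp
  consider "j + 3 \<le> m" | "j = m - 2" | "j = m - 1" | "j = m" | "m < j" "j + 1 < 2 * m" |
      "j = 2 * m - 1"
    using assms(2) by linarith
  then show ?thesis
  proof cases
    case 1
    then show ?thesis
      using last_left[of j] m i by (simp add: sq_last)
  next
    case 2
    then have "j + 2 = m"
      using m by simp
    then show ?thesis
      using 2 last_m_2 m i by (simp add: sq_last)
  next
    case 3
    then show ?thesis
      using last_m_1 m i by (simp add: sq_last)
  next
    case case4: 4
    then show ?thesis
      using last_m m i by (simp add: sq_last)
  next
    case 5
    then show ?thesis
      using right_cols[of j] m i by (simp add: sq_last)
  next
    case 6
    then show ?thesis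
      using last_last m i by (simp add: sq_last)
  qed
qed

end

subsection \<open>Conclusion\<close>

text \<open>Symmetry handles the hypotenuse of the corner outside column \<open>0\<close>, the inner
  edge of the wedge below row \<open>m\<close>, and the entry of the last row in column
  \<open>m\<close>. All other entries have a direct trade.\<close>

lemma necessary_crit:
  assumes m: "3 \<le> m" and t: "t \<in> crit m"
  shows "necessary m t"
proof -
  obtain i j k where tijk: "t = (i, j, k)"
    using prod_cases3 by blast
  have t': "(i, j, k) \<in> crit m"
    using t tijk by simp
  define k' where "k' = flip m j"
  have conj: "conjugate m t = (i, flip m k, k')"
    by (simp add: tijk conjugate_def k'_def)
  have conj': "(i, flip m k, k') \<in> crit m"
    using conjugate_crit[OF m t] conj by simp
  note by_symmetry = necessary_conjugate[OF m t, unfolded conj]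
  consider "i + j + 2 \<le> m" "k = i + j" | "i = m" "j + 1 = m" "k + 1 = 2 * m"
    | "i = m" "m < j" "j + 1 < 2 * m" "k + 1 = j"
    | "m \<le> i" "i + 1 < 2 * m" "3 * m \<le> i + j + 1" "k + 2 * m = i + j" "j < 2 * m"
    | "i + 1 = 2 * m" "j = m" "k + 1 = m" | "i + 1 = 2 * m" "j + 1 = 2 * m" "k + 2 = 2 * m"
    using t by (auto simp: crit_def tijk)
  then show ?thesis
  proof cases
    case 1
    have flip: "flip m k = 0" if "i + j + 2 = m"
      using that 1 by (simp add: flip_def)
    consider "i = 0" | "0 < i" "j = 0" | "0 < i" "0 < j"
      by blast
    then show ?thesis
    proof cases
      case i0: 1
      consider "j = 0" | "0 < j" "j + 3 \<le> m" | "j + 2 = m"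
        using 1 by linarith
      then show ?thesis
      proof cases
        case 1
        then show ?thesis
          using necessary_origin[OF m] t' tijk i0 by simp
      next
        case 2
        then show ?thesis
          using necessary_first_row[OF m 2] t' tijk i0 by simp
      next
        case 3
        then show ?thesis
          using by_symmetry necessary_origin[OF m] conj' flip i0 by simp
      qed
    next
      case 2
      consider "i + 2 = m" | "i + 3 \<le> m"
        using 1 by linarith
      then show ?thesis
        by cases (use necessary_corner_bottom[OF m] necessary_left_col[OF 2(1)] t' tijk 2 in simp_all)
    next
      case 3
      consider "i + j + 2 = m" | "i + j + 3 \<le> m"
        using 1 by linarith
      then show ?thesis
      proof cases
        case 1
        then have "i + 3 \<le> m"
          using 3 by linarith
        then show ?thesis
          using by_symmetry necessary_left_col[of i m k'] conj' flip[OF 1] 3 by simp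
      next
        case 2
        then show ?thesis
          using necessary_corner_interior[OF m 3] t' tijk by simp
      qed
    qed
  next
    case 2
    then have "j = m - 1"
      by simp
    then show ?thesis
      using necessary_mid_extra[OF m] t' 2 tijk by simp
  next
    case 3
    then show ?thesis
      using necessary_mid_row[OF m] t' tijk by simp
  next
    case 4
    consider "i = m" | "m < i" "j = 2 * m - 1" | "m < i" "j + 1 < 2 * m" "3 * m \<le> i + j" |
        "m < i" "i + j + 1 = 3 * m"
      using 4 by linarith
    then show ?thesis
    proof cases
      case 1
      then have j: "j = 2 * m - 1"
        using 4 by linarith
      show ?thesis
      proof (cases "odd m")
        case True
        then obtain h where "m = 2 * h + 1"
          by (rule oddE)
        then show ?thesis
          using necessary_mid_end_odd[OF m] t' tijk j \<open>i = m\<close> by simp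
      next
        case False
        then obtain h where "m = 2 * h"
          by auto
        then have "m = 2 * (h - 1) + 2" "0 < h - 1"
          using m by auto
        then show ?thesis
          using necessary_mid_end_even[of m "h - 1" k] t' tijk j \<open>i = m\<close> by simp
      qed
    next
      case 2
      have "i = m + (i - m - 1) + 1" "i - m - 1 + 3 \<le> m"
        using 2 4 by linarith+
      then show ?thesis
        using necessary_right_col[of "i - m - 1" m k] t' tijk 2 by simp
    next
      case 3
      then show ?thesis
        using necessary_wedge_interior[OF m] t' tijk 4 by simp
    next
      case case4: 4
      then have "k = m - 1"
        using 4 by linarith
      then have "flip m k = 2 * m - 1"
        using m by (auto simp: flip_def)
      moreover have "i = m + (i - m - 1) + 1" "i - m - 1 + 3 \<le> m"
        using case4 4 by linarith+
      ultimately show ?thesis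
        using by_symmetry necessary_right_col[of "i - m - 1" m k'] conj' by simp
    qed
  next
    case 5
    then have "flip m k = 2 * m - 1" "i = 2 * m - 1"
      using m by (auto simp: flip_def)
    then show ?thesis
      using by_symmetry necessary_last_end[OF m] conj' by simp
  next
    case 6
    then have "i = 2 * m - 1" "j = 2 * m - 1"
      by linarith+
    then show ?thesis
      using necessary_last_end[OF m] t' tijk by simp
  qed
qed

lemma unique_completion:
  assumes m: "3 \<le> m" and L: "latin_square (2 * m) L" "crit m \<subseteq> L"
  shows "L = graph (2 * m) (sq m)"
proof -
  obtain M where M: "latin_fun (2 * m) M" "L = graph (2 * m) M"
    using latin_square_imp_graph[OF L(1)] .
  have entry: "M i j = k" if "(i, j, k) \<in> crit m" for i j k
    using that L(2) M(2) by auto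
  interpret completion m M
  proof
    show "M i j = i + j" if "i + j + 2 \<le> m" for i j
      using that by (intro entry) (simp add: crit_def)
    show "M m (m - 1) = 2 * m - 1"
      using m by (intro entry) (simp add: crit_def)
    show "M m (k + 1) = k" if "m \<le> k" "k + 2 < 2 * m" for k
      using that by (intro entry) (simp add: crit_def)
    show "M i j = k" if "m \<le> i" "i + 1 < 2 * m" "j < 2 * m" "m \<le> k + 1" "k + 2 * m = i + j"
        for i j k
      using that by (intro entry) (simp add: crit_def)
    show "M (2 * m - 1) m = m - 1"
      using m by (intro entry) (simp add: crit_def)
    show "M (2 * m - 1) (2 * m - 1) = 2 * m - 2"
      using m by (intro entry) (auto simp: crit_def)
  qed (use m M in auto)
  have "(i, j, k) \<in> L \<longleftrightarrow> (i, j, k) \<in> graph (2 * m) (sq m)" for i j k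
    using eq_sq[of i j] by (auto simp: M(2))
  then show ?thesis
    by auto
qed

theorem theorem6:
  fixes n :: nat
  assumes "n \<ge> 6" and "even n"
  shows "critical_set n (set_D n) \<and> card (set_D n) = n ^ 2 div 4 + 1"
proof -
  obtain m where n: "n = 2 * m"
    using \<open>even n\<close> by blast
  then have m: "3 \<le> m"
    using \<open>n \<ge> 6\<close> by simp
  have D: "set_D n = crit m"
    unfolding n by (rule set_D_eq_crit[OF m])
  have card: "card (set_D n) = m\<^sup>2 + 1"
    unfolding D by (rule card_crit[OF m])
  have L: "latin_square n (graph n (sq m))" "crit m \<subseteq> graph n (sq m)"
  proof -
    show "latin_square n (graph n (sq m))"
      unfolding n by (rule latin_square_graph[OF latin_fun_sq[OF m]])
    show "crit m \<subseteq> graph n (sq m)"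
    proof (rule subsetI)
      fix t assume t: "t \<in> crit m"
      obtain i j k where "t = (i, j, k)"
        using prod_cases3 by blast
      moreover have "i < n \<and> j < n" if "(i, j, k) \<in> crit m"
        using that by (simp add: crit_def n)
      ultimately show "t \<in> graph n (sq m)"
        using t crit_imp_sq[OF m, of i j k] by simp
    qed
  qed
  \<comment> \<open>Properness follows by counting, as \<open>m^2 + 1 < 4 * m^2\<close>.\<close>
  have "1 < m\<^sup>2"
    using m by (intro one_less_power) auto
  then have "card (crit m) < card (graph n (sq m))"
    unfolding card_crit[OF m] card_graph n by (simp add: power_mult_distrib)
  then have proper: "crit m \<subset> graph n (sq m)"
    using L(2) by (metis less_irrefl psubsetI)
  have completable: "\<exists>!L. latin_square n L \<and> crit m \<subseteq> L"
  proof (rule ex1I)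
    show "latin_square n (graph n (sq m)) \<and> crit m \<subseteq> graph n (sq m)"
      using L by simp
    show "L = graph n (sq m)" if "latin_square n L \<and> crit m \<subseteq> L" for L
      using unique_completion[OF m, of L] that unfolding n by simp
  qed
  have necessary: "\<exists>L L'. latin_square n L \<and> latin_square n L' \<and> L \<noteq> L' \<and> crit m - {t} \<subseteq> L \<and> crit m - {t} \<subseteq> L'"
    if "t \<in> crit m" for t
    using necessary_crit[OF m that] unfolding necessary_def n .
  have "critical_set n (crit m)"
    unfolding critical_set_def
  proof (intro conjI ballI)
    show "\<exists>L. latin_square n L \<and> crit m \<subset> L"
      using L(1) proper by blast
  qed (fact completable, erule necessary)
  moreover have "n ^ 2 div 4 + 1 = m\<^sup>2 + 1"
    unfolding n by (simp add: power2_eq_square)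
  ultimately show ?thesis
    using card D by simp
qed

end
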